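(* The alternating group $\mathbb{A}_5$ is $\kappa$-recognizable in the class $\mathcal{S}$ of all finite simple groups, i.e. $h_{\mathcal{S}}(\mathbb{A}_5)=1$. Explicitly: if $H$ is a finite simple group (abelian or non-abelian) with $\kappa(H)=\kappa(\mathbb{A}_5)$, then $H\cong \mathbb{A}_5$.
   Context: For a finite group $G$, the power graph $\mathcal{P}(G)$ is the simple undirected graph whose vertices are the elements of $G$, two distinct vertices $x,y$ being adjacent iff $\langle x\rangle\subseteq\langle y\rangle$ or $\langle y\rangle\subseteq\langle x\rangle$. $\kappa(G)$ denotes the number of spanning trees of $\mathcal{P}(G)$. For a class $\mathcal{C}$ of finite groups and $G\in\mathcal{C}$, $h_{\mathcal{C}}(G)$ is the (possibly infinite) number of pairwise non-isomorphic groups $H\in\mathcal{C}$ with $\kappa(H)=\kappa(G)$; $G$ is called $\kappa$-recognizable in $\mathcal{C}$ if $h_{\mathcal{C}}(G)=1$. *)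

theory Defs
  imports "HOL-Algebra.Algebra" "HOL-Library.Extended_Nat"
begin

section \<open>Simple undirected graphs and spanning trees\<close>

record 'v ugraph =
  verts :: "'v set"
  edges :: "'v set set"

definition simple_ugraph :: "'v ugraph \<Rightarrow> bool" where
  "simple_ugraph \<Gamma> \<longleftrightarrow> (\<forall>e \<in> edges \<Gamma>. e \<subseteq> verts \<Gamma> \<and> card e = 2)"

definition connected_ugraph :: "'v ugraph \<Rightarrow> bool" where
  "connected_ugraph \<Gamma> \<longleftrightarrow> verts \<Gamma> \<noteq> {} \<and>
     (\<forall>u \<in> verts \<Gamma>. \<forall>v \<in> verts \<Gamma>. (u, v) \<in> {(x, y). {x, y} \<in> edges \<Gamma>}\<^sup>*)"

text \<open>A cycle is given by its distinct vertices in cyclic order.\<close>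

definition cycle_in :: "'v ugraph \<Rightarrow> 'v list \<Rightarrow> bool" where
  "cycle_in \<Gamma> xs \<longleftrightarrow> length xs \<ge> 3 \<and> distinct xs \<and>
     (\<forall>i < length xs. {xs ! i, xs ! (Suc i mod length xs)} \<in> edges \<Gamma>)"

definition tree_ugraph :: "'v ugraph \<Rightarrow> bool" where
  "tree_ugraph \<Gamma> \<longleftrightarrow> simple_ugraph \<Gamma> \<and> connected_ugraph \<Gamma> \<and> (\<nexists>xs. cycle_in \<Gamma> xs)"

definition spanning_tree :: "'v ugraph \<Rightarrow> 'v ugraph \<Rightarrow> bool" where
  "spanning_tree T \<Gamma> \<longleftrightarrow> tree_ugraph T \<and> verts T = verts \<Gamma> \<and> edges T \<subseteq> edges \<Gamma>"


section \<open>Power graphs\<close>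

definition power_graph :: "('a, 'b) monoid_scheme \<Rightarrow> 'a ugraph" where
  "power_graph G = \<lparr> verts = carrier G,
     edges = {{x, y} | x y. x \<in> carrier G \<and> y \<in> carrier G \<and> x \<noteq> y \<and>
       (generate G {x} \<subseteq> generate G {y} \<or> generate G {y} \<subseteq> generate G {x})} \<rparr>"

definition kappa :: "('a, 'b) monoid_scheme \<Rightarrow> nat" where
  "kappa G = card {T. spanning_tree T (power_graph G)}"


section \<open>Recognizability\<close>

text \<open>
  A class of finite groups is represented by the set of its members with underlying set in a
  fixed type. If that type is infinite, every finite group has an isomorphic copy there, so
  counting isomorphism classes in the type counts all of them.
\<close>

definition kappa_num :: "'a monoid set \<Rightarrow> 'a monoid \<Rightarrow> enat" where
  "kappa_num C G =
     (let M = {H \<in> C. kappa H = kappa G};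
          Q = M // {(H, K). H \<in> M \<and> K \<in> M \<and> H \<cong> K}
      in if finite Q then enat (card Q) else \<infinity>)"

definition kappa_recognizable :: "'a monoid set \<Rightarrow> 'a monoid \<Rightarrow> bool" where
  "kappa_recognizable C G \<longleftrightarrow> G \<in> C \<and> kappa_num C G = 1"

definition finite_simple_groups :: "'a monoid set" where
  "finite_simple_groups = {H. simple_group H \<and> finite (carrier H)}"

end

theory Submission
  imports Defs "HOL-Library.Transitive_Closure_Table"
begin

text \<open>
  The identity is adjacent to every other vertex of a power graph. Rooting spanning trees there
  turns them into parent functions, that is, into rooted forests on the non-identity elements
  (\<open>card_spanning_trees\<close>), and these are easy to count. Elements generating the same cyclic
  subgroup form cliques, so Cayley's formula gives the lower bound
  \<open>\<kappa>(G) \<ge> \<Prod> (c + 1) ^ (c - 1)\<close>, where \<open>c\<close> runs over the numbers of generators of the nontrivial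
  cyclic subgroups (\<open>kappa_ge_prod\<close>). If all nontrivial elements have prime order there are no
  other edges, and equality holds (\<open>kappa_eq_prod_if_prime_orders\<close>). Finally, an element of even
  order other than 2 and its inverse have the same neighbours, an even number of them apart from
  each other; exchanging the two elements in a forest then shows that \<open>\<kappa>(G)\<close> is even
  (\<open>even_kappa_if_even_ord\<close>).

  Let \<open>G\<close> be finite and simple with \<open>\<kappa>(G) = 3 ^ 10 * 5 ^ 18\<close>, the value at the alternating group.
  This number is odd, so elements of even order are involutions. A cyclic subgroup of odd order
  \<open>n \<ge> 7\<close> has at least 6 generators; as \<open>\<kappa>(G) < 7 ^ 25\<close>, there are at most 4 such subgroups of order
  \<open>n\<close>. The twelfth power of a generator of one of them acts trivially on these by conjugation but is
  not 1, so by simplicity the whole group acts trivially. Then \<open>G\<close> is cyclic of order \<open>n\<close>, and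
  \<open>\<kappa>(G) = n ^ (n - 2)\<close> with \<open>n\<close> prime, which is impossible. Hence all elements have order 1, 2, 3 or 5
  (\<open>orders_if_kappa\<close>), the product formula is exact, and unique factorization yields 20 elements of
  order 3 and 24 elements of order 5.

  These numbers determine \<open>G\<close>. The centralizer of an element of order 5 has order 5; otherwise it would
  consist of the identity and all 24 elements of order 5, and be normal. Hence all classes of elements
  of order 5 have the same size \<open>|G| / 5\<close>, which divides 24 and is at least 9. It is at most 12, because
  an element of order 5 is not conjugate to its square as long as no element has order 4. So it is 12,
  and \<open>|G| = 60\<close> (\<open>order_if_kappa\<close>). The 15 involutions have only 5
  distinct centralizers, each of order 4. Conjugation permutes these, which embeds \<open>G\<close> into the
  symmetric group of degree 5; the image consists of even permutations because \<open>G\<close> has no normal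
  subgroup of index 2 (\<open>iso_alt_group_5\<close>).

  That the alternating group itself has these element orders is checked by enumerating its 60
  elements; the class sizes 15, 20, 12 and 12 then show that it is simple.
\<close>


section \<open>Rooted forests and spanning trees\<close>

text \<open>
  A member of this set sends each vertex of \<open>A\<close> to its parent, chosen among its neighbours. On a
  finite set \<open>A\<close>, the absence of nonempty invariant subsets means that following parents always
  leads out of \<open>A\<close>: the members are the forests on \<open>A\<close> whose roots lie outside \<open>A\<close>.
\<close>

definition forests :: "('v \<Rightarrow> 'v set) \<Rightarrow> 'v set \<Rightarrow> ('v \<Rightarrow> 'v) set" where
  "forests N A = {f \<in> Pi\<^sub>E A N. \<forall>B \<subseteq> A. f ` B \<subseteq> B \<longrightarrow> B = {}}"

lemma forests_no_invariant:
  "f \<in> forests N A \<Longrightarrow> B \<subseteq> A \<Longrightarrow> f ` B \<subseteq> B \<Longrightarrow> B = {}"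
  by (auto simp: forests_def)

lemma forestsI:
  assumes "f \<in> extensional A" "\<And>a. a \<in> A \<Longrightarrow> f a \<in> N a"
    "\<And>B. B \<subseteq> A \<Longrightarrow> f ` B \<subseteq> B \<Longrightarrow> B = {}"
  shows "f \<in> forests N A"
  using assms by (auto simp: forests_def PiE_def)

lemma forestsD:
  assumes "f \<in> forests N A"
  shows "f \<in> extensional A" "a \<in> A \<Longrightarrow> f a \<in> N a"
  using assms by (auto simp: forests_def PiE_def)

lemma forests_no_fixpoint:
  assumes "f \<in> forests N A" "a \<in> A" shows "f a \<noteq> a"
  using forests_no_invariant[OF assms(1), of "{a}"] assms(2) by auto

lemma finite_forests:
  assumes "finite A" "\<And>a. a \<in> A \<Longrightarrow> finite (N a)"
  shows "finite (forests N A)"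
proof -
  have "finite (Pi\<^sub>E A N)" using assms by (intro finite_PiE) auto
  then show ?thesis unfolding forests_def by simp
qed

lemma forests_mono:
  assumes "\<And>a. a \<in> A \<Longrightarrow> N a \<subseteq> M a"
  shows "forests N A \<subseteq> forests M A"
  using assms by (fastforce simp: forests_def PiE_def Pi_def)

lemma forests_cong:
  assumes "\<And>a. a \<in> A \<Longrightarrow> N a = M a"
  shows "forests N A = forests M A"
  using forests_mono[of A N M] forests_mono[of A M N] assms by auto

lemma forests_remove_self: "forests (\<lambda>a. N a - {a}) A = forests N A"
proof
  show "forests N A \<subseteq> forests (\<lambda>a. N a - {a}) A"
    using forests_no_fixpoint[of _ N A] by (auto intro!: forestsI dest: forestsD forests_no_invariant)
qed (auto intro: forests_mono[THEN subsetD])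

definition parent_tree :: "'v set \<Rightarrow> 'v \<Rightarrow> ('v \<Rightarrow> 'v) \<Rightarrow> 'v ugraph" where
  "parent_tree V r f = \<lparr> verts = V, edges = (\<lambda>v. {v, f v}) ` (V - {r}) \<rparr>"

text \<open>
  The vertices without a path to \<open>r\<close> are closed under taking parents.
\<close>

lemma parent_tree_connected:
  assumes r: "r \<in> V" and f: "f \<in> forests N (V - {r})" and N: "\<And>v. v \<in> V - {r} \<Longrightarrow> N v \<subseteq> V"
  shows "connected_ugraph (parent_tree V r f)"
proof -
  let ?E = "edges (parent_tree V r f)"
  let ?R = "{(x, y). {x, y} \<in> ?E}"
  have sym: "sym (?R\<^sup>*)" by (rule sym_rtrancl) (auto simp: sym_def insert_commute)
  let ?B = "{v \<in> V - {r}. (v, r) \<notin> ?R\<^sup>*}"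
  have "f ` ?B \<subseteq> ?B"
  proof
    fix w assume "w \<in> f ` ?B"
    then obtain v where v: "v \<in> V - {r}" "(v, r) \<notin> ?R\<^sup>*" "w = f v" by auto
    have "(v, w) \<in> ?R" using v by (auto simp: parent_tree_def)
    then have "(w, r) \<notin> ?R\<^sup>*" using v(2) by (meson converse_rtrancl_into_rtrancl)
    moreover have "w \<in> V" using forestsD(2)[OF f v(1)] N[OF v(1)] v(3) by auto
    ultimately show "w \<in> ?B" by auto
  qed
  then have "?B = {}" using forests_no_invariant[OF f, of ?B] by blast
  then have *: "(v, r) \<in> ?R\<^sup>*" if "v \<in> V" for v using that by auto
  show ?thesis unfolding connected_ugraph_def
  proof (intro conjI ballI)
    show "verts (parent_tree V r f) \<noteq> {}" using r by (auto simp: parent_tree_def)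
  next
    fix u v assume "u \<in> verts (parent_tree V r f)" "v \<in> verts (parent_tree V r f)"
    then have "(u, r) \<in> ?R\<^sup>*" "(r, v) \<in> ?R\<^sup>*"
      using *[of u] *[of v] symD[OF sym] by (auto simp: parent_tree_def)
    then show "(u, v) \<in> ?R\<^sup>*" by (rule rtrancl_trans)
  qed
qed

text \<open>
  Following parents cannot permute the vertices of a cycle, so some vertex of the cycle is the
  parent of no other one. Both its neighbours on the cycle would then have to be its parent.
\<close>

lemma parent_tree_acyclic:
  assumes "finite V" and f: "f \<in> forests N (V - {r})"
  shows "\<not> cycle_in (parent_tree V r f) xs"
proof
  assume cyc: "cycle_in (parent_tree V r f) xs"
  let ?n = "length xs" and ?B = "set xs \<inter> (V - {r})"
  have n: "?n \<ge> 3" and d: "distinct xs"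
    and e: "\<And>i. i < ?n \<Longrightarrow> {xs ! i, xs ! (Suc i mod ?n)} \<in> (\<lambda>v. {v, f v}) ` (V - {r})"
    using cyc by (auto simp: cycle_in_def parent_tree_def)
  \<comment> \<open>If \<open>f\<close> maps the finite set \<open>?B\<close> onto a superset, it permutes it.\<close>
  have "\<not> set xs \<subseteq> f ` ?B"
  proof
    assume sub: "set xs \<subseteq> f ` ?B"
    have "card (set xs) \<le> card (f ` ?B)" by (rule card_mono[OF _ sub]) simp
    also have "\<dots> \<le> card ?B" by (rule card_image_le) simp
    finally have "?B = set xs" by (intro card_seteq) auto
    moreover from this have "card (f ` ?B) \<le> card (set xs)" using card_image_le[of ?B f] by simp
    then have "set xs = f ` ?B" by (intro card_seteq[OF _ sub]) auto
    ultimately have "?B = {}" using forests_no_invariant[OF f, of ?B] by auto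
    then show False using \<open>?B = set xs\<close> n by auto
  qed
  then obtain v where v: "v \<in> set xs" "v \<notin> f ` ?B" by blast
  then obtain i where i: "i < ?n" "v = xs ! i" by (auto simp: in_set_conv_nth)
  have parent: "f v = w" if "{v, w} \<in> (\<lambda>v. {v, f v}) ` (V - {r})" "w \<in> set xs" for w
  proof -
    from that(1) obtain c where c: "c \<in> V - {r}" "{v, w} = {c, f c}" by auto
    then consider "v = c" "w = f c" | "w = c" "v = f c" by (auto simp: doubleton_eq_iff)
    then show ?thesis
    proof cases
      case 2 then show ?thesis using v(2) c(1) that(2) by auto
    qed simp
  qed
  \<comment> \<open>The position before \<open>i\<close> on the cycle.\<close>
  define j where "j = (i + ?n - 1) mod ?n"
  have j: "j < ?n" unfolding j_def using n by (intro mod_less_divisor) linarith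
  have ji: "Suc j mod ?n = i"
  proof -
    have "Suc j mod ?n = Suc (i + ?n - 1) mod ?n" unfolding j_def by (simp add: mod_Suc_eq)
    also have "Suc (i + ?n - 1) = i + ?n" using n by simp
    finally show ?thesis using i(1) by simp
  qed
  have i': "Suc i mod ?n < ?n" using n by (intro mod_less_divisor) linarith
  have "f v = xs ! (Suc i mod ?n)"
    by (rule parent) (use e[OF i(1)] i i' in auto)
  moreover have "f v = xs ! j"
    by (rule parent) (use e[OF j] ji i j in \<open>auto simp: insert_commute\<close>)
  ultimately have "Suc i mod ?n = j"
    using nth_eq_iff_index_eq[OF d i' j] by simp
  then have "Suc (Suc i mod ?n) mod ?n = i" using ji by simp
  then have "(i + 2) mod ?n = i" by (simp add: mod_Suc_eq)
  moreover have "(i + 2) mod ?n = (if i + 2 < ?n then i + 2 else i + 2 - ?n)"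
    using i(1) n by (auto simp: le_mod_geq)
  ultimately show False using i(1) n by (auto split: if_splits)
qed

text \<open>
  The vertices where two parent functions with the same edges differ are invariant: if \<open>f b \<noteq> g b\<close>,
  the edge \<open>{b, f b}\<close> is directed from \<open>f b\<close> to \<open>b\<close> by \<open>g\<close>, but cannot be so by \<open>f\<close> as well, and so
  \<open>f\<close> and \<open>g\<close> also differ at \<open>f b\<close>.
\<close>

lemma parent_tree_inj:
  assumes "r \<in> V" "\<And>v. v \<in> V - {r} \<Longrightarrow> N v \<subseteq> V"
  shows "inj_on (parent_tree V r) (forests N (V - {r}))"
proof (rule inj_onI)
  fix f g assume f: "f \<in> forests N (V - {r})" and g: "g \<in> forests N (V - {r})"
    and eq: "parent_tree V r f = parent_tree V r g"
  let ?A = "V - {r}"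
  have E: "(\<lambda>v. {v, f v}) ` ?A = (\<lambda>v. {v, g v}) ` ?A"
    using arg_cong[OF eq, of edges] by (simp add: parent_tree_def)
  let ?B = "{v \<in> ?A. f v \<noteq> g v}"
  have "f ` ?B \<subseteq> ?B"
  proof
    fix c assume "c \<in> f ` ?B"
    then obtain b where b: "b \<in> ?A" "f b \<noteq> g b" "c = f b" by auto
    then have "{b, c} \<in> (\<lambda>v. {v, g v}) ` ?A" using E by auto
    then have c: "c \<in> ?A" "g c = b" using b(2,3) by (auto simp: doubleton_eq_iff)
    moreover have "f c \<noteq> g c"
    proof
      assume "f c = g c"
      then have "f ` {b, c} \<subseteq> {b, c}" using b c by auto
      then show False using forests_no_invariant[OF f, of "{b, c}"] b c by auto
    qed
    ultimately show "c \<in> ?B" by auto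
  qed
  then have "?B = {}" using forests_no_invariant[OF f, of ?B] by blast
  then show "f = g" using forestsD(1)[OF f] forestsD(1)[OF g] by (intro extensionalityI) auto
qed

lemma edge_closing_path_gives_cycle:
  assumes path: "rtrancl_path (\<lambda>x y. {x, y} \<in> F) u ps w" and d: "distinct (u # ps)"
    and F: "F \<subseteq> edges T" and uw: "{u, w} \<in> edges T" "{u, w} \<notin> F" "u \<noteq> w"
  shows "cycle_in T (u # ps)"
proof -
  have last: "ps \<noteq> [] \<longrightarrow> last ps = w" and nil: "ps = [] \<longrightarrow> u = w"
    and steps: "\<forall>i < length ps. {(u # ps) ! i, (u # ps) ! Suc i} \<in> F"
    using path
  proof (induction)
    case (step x y ys z)
    { case 1 then show ?case using step.IH by auto }
    { case 2 then show ?case by simp }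
    { case 3
      show ?case
      proof (intro allI impI)
        fix i assume "i < length (y # ys)"
        then show "{(x # y # ys) ! i, (x # y # ys) ! Suc i} \<in> F"
          using step.hyps(1) step.IH(3) by (cases i) auto
      qed }
  qed auto
  have ne: "ps \<noteq> []" using nil uw by auto
  have len: "length ps \<ge> 2"
  proof (rule ccontr)
    assume "\<not> length ps \<ge> 2"
    then obtain p where "ps = [p]" using ne by (cases ps) (auto simp: Suc_le_eq)
    then show False using steps last uw by auto
  qed
  show ?thesis unfolding cycle_in_def
  proof (intro conjI allI impI)
    fix i assume i: "i < length (u # ps)"
    show "{(u # ps) ! i, (u # ps) ! (Suc i mod length (u # ps))} \<in> edges T"
    proof (cases "i = length ps")
      case True
      then have "(u # ps) ! i = w" using last ne by (simp add: last_conv_nth nth_Cons')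
      then show ?thesis using True uw(1) by (simp add: insert_commute)
    next
      case False
      then show ?thesis using steps i F by auto
    qed
  qed (use len d in auto)
qed

text \<open>
  As parent of a vertex serves a neighbour that is nearer to the root. The edges obtained in this way
  already connect everything, so any further edge would close a cycle.
\<close>

lemma parent_tree_surj:
  assumes V: "finite V" "r \<in> V" and T: "tree_ugraph T" "verts T = V"
  obtains f where "f \<in> forests (\<lambda>v. {w. {v, w} \<in> edges T}) (V - {r})" "T = parent_tree V r f"
proof -
  let ?R = "{(x, y). {x, y} \<in> edges T}"
  have sub: "e \<subseteq> V" "card e = 2" if "e \<in> edges T" for e
    using T that by (auto simp: tree_ugraph_def simple_ugraph_def)
  have reach: "(v, r) \<in> ?R\<^sup>*" if "v \<in> V" for v
    using T V that by (auto simp: tree_ugraph_def connected_ugraph_def)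
  define d where "d v = (LEAST n. (v, r) \<in> ?R ^^ n)" for v
  have d: "(v, r) \<in> ?R ^^ d v" if "v \<in> V" for v
  proof -
    have "\<exists>n. (v, r) \<in> ?R ^^ n" using reach[OF that] by (simp only: rtrancl_power)
    then show ?thesis unfolding d_def by (rule LeastI_ex)
  qed
  have "\<exists>w. {v, w} \<in> edges T \<and> d w < d v" if v: "v \<in> V - {r}" for v
  proof -
    have "d v \<noteq> 0" using d[of v] v by (cases "d v = 0") auto
    then obtain m where m: "d v = Suc m" by (cases "d v") auto
    have "(v, r) \<in> ?R ^^ Suc m" using d[of v] v m by simp
    from relpow_Suc_D2[OF this] obtain w where w: "(v, w) \<in> ?R" "(w, r) \<in> ?R ^^ m" by blast
    have "d w \<le> m" unfolding d_def by (rule Least_le) (rule w(2))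
    then show ?thesis using w m by auto
  qed
  then obtain p where p: "\<And>v. v \<in> V - {r} \<Longrightarrow> {v, p v} \<in> edges T \<and> d (p v) < d v" by metis
  define f where "f = restrict p (V - {r})"
  have f: "{v, f v} \<in> edges T" "d (f v) < d v" if "v \<in> V - {r}" for v
    using p that by (auto simp: f_def)
  have ff: "f \<in> forests (\<lambda>v. {w. {v, w} \<in> edges T}) (V - {r})"
  proof (rule forestsI)
    fix B assume B: "B \<subseteq> V - {r}" "f ` B \<subseteq> B"
    show "B = {}"
    proof (rule ccontr)
      assume "B \<noteq> {}"
      then obtain b where b: "b \<in> B" "\<And>c. c \<in> B \<Longrightarrow> d b \<le> d c"
        using ex_has_least_nat[of "\<lambda>x. x \<in> B" _ d] by blast
      have "d b \<le> d (f b)" using b B by auto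
      moreover have "d (f b) < d b" using f(2)[of b] b(1) B by auto
      ultimately show False by simp
    qed
  qed (use f in \<open>auto simp: f_def\<close>)
  let ?F = "(\<lambda>v. {v, f v}) ` (V - {r})"
  have FT: "?F \<subseteq> edges T" using f by auto
  have con: "connected_ugraph (parent_tree V r f)"
    by (rule parent_tree_connected[OF V(2) ff]) (use sub in auto)
  have "edges T \<subseteq> ?F"
  proof
    fix e assume e: "e \<in> edges T"
    obtain u w where uw: "e = {u, w}" "u \<noteq> w" using sub(2)[OF e] by (auto simp: card_2_iff)
    show "e \<in> ?F"
    proof (rule ccontr)
      assume ne: "e \<notin> ?F"
      have "u \<in> V" "w \<in> V" using sub(1)[OF e] uw by auto
      then have "(u, w) \<in> {(x, y). {x, y} \<in> ?F}\<^sup>*"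
        using con unfolding connected_ugraph_def by (auto simp: parent_tree_def)
      then have "(\<lambda>x y. {x, y} \<in> ?F)\<^sup>*\<^sup>* u w" by (simp add: rtranclp_rtrancl_eq)
      then obtain ps0 where "rtrancl_path (\<lambda>x y. {x, y} \<in> ?F) u ps0 w"
        by (auto simp: rtranclp_eq_rtrancl_path)
      then obtain ps where "rtrancl_path (\<lambda>x y. {x, y} \<in> ?F) u ps w" "distinct (u # ps)"
        by (rule rtrancl_path_distinct)
      from edge_closing_path_gives_cycle[OF this FT] e ne uw have "cycle_in T (u # ps)" by auto
      then show False using T by (auto simp: tree_ugraph_def)
    qed
  qed
  then have "T = parent_tree V r f"
    using FT T(2) by (auto intro!: ugraph.equality simp: parent_tree_def)
  then show ?thesis using ff that by blast
qed

theorem card_spanning_trees: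
  assumes V: "finite (verts \<Gamma>)" "r \<in> verts \<Gamma>" and sg: "simple_ugraph \<Gamma>"
  shows "card {T. spanning_tree T \<Gamma>} = card (forests (\<lambda>v. {w. {v, w} \<in> edges \<Gamma>}) (verts \<Gamma> - {r}))"
proof -
  let ?V = "verts \<Gamma>" and ?N = "\<lambda>v. {w. {v, w} \<in> edges \<Gamma>}"
  have NV: "?N v \<subseteq> ?V" for v using sg by (auto simp: simple_ugraph_def)
  have "parent_tree ?V r ` forests ?N (?V - {r}) = {T. spanning_tree T \<Gamma>}"
  proof (intro equalityI subsetI)
    fix T assume "T \<in> parent_tree ?V r ` forests ?N (?V - {r})"
    then obtain f where f: "f \<in> forests ?N (?V - {r})" and T: "T = parent_tree ?V r f" by auto
    have E: "edges T \<subseteq> edges \<Gamma>" using forestsD(2)[OF f] by (auto simp: T parent_tree_def)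
    have "verts T = ?V" by (simp add: T parent_tree_def)
    moreover have "simple_ugraph T" using E sg \<open>verts T = ?V\<close> by (auto simp: simple_ugraph_def)
    ultimately show "T \<in> {T. spanning_tree T \<Gamma>}"
      using E parent_tree_connected[OF V(2) f NV] parent_tree_acyclic[OF V(1) f]
      by (auto simp: spanning_tree_def tree_ugraph_def T)
  next
    fix T assume "T \<in> {T. spanning_tree T \<Gamma>}"
    then have T: "tree_ugraph T" "verts T = ?V" "edges T \<subseteq> edges \<Gamma>" by (auto simp: spanning_tree_def)
    obtain f where f: "f \<in> forests (\<lambda>v. {w. {v, w} \<in> edges T}) (?V - {r})" "T = parent_tree ?V r f"
      by (rule parent_tree_surj[OF V T(1,2)])
    have "f \<in> forests ?N (?V - {r})" by (rule forests_mono[THEN subsetD, OF _ f(1)]) (use T in auto)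
    then show "T \<in> parent_tree ?V r ` forests ?N (?V - {r})" using f by auto
  qed
  then show ?thesis using card_image[OF parent_tree_inj[where N = ?N, OF V(2) NV]] by simp
qed

section \<open>Counting rooted forests\<close>

text \<open>
  All counts of forests below split the domain into two parts on which the function is chosen
  independently.
\<close>

lemma card_glued_functions:
  assumes AB: "A \<inter> B = {}" and K: "K \<subseteq> extensional A" and Y: "Y \<subseteq> extensional B"
  shows "card {f \<in> extensional (A \<union> B). restrict f A \<in> K \<and> restrict f B \<in> Y} = card K * card Y"
proof -
  let ?Z = "{f \<in> extensional (A \<union> B). restrict f A \<in> K \<and> restrict f B \<in> Y}"
  have "bij_betw (\<lambda>f. (restrict f A, restrict f B)) ?Z (K \<times> Y)"
  proof (rule bij_betwI[where g = "\<lambda>(g, h) x. if x \<in> A then g x else h x"])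
    show "(\<lambda>(g, h) x. if x \<in> A then g x else h x) \<in> K \<times> Y \<rightarrow> ?Z"
    proof (clarify, intro conjI)
      fix g h assume gh: "g \<in> K" "h \<in> Y"
      let ?f = "\<lambda>x. if x \<in> A then g x else h x"
      have ext: "g \<in> extensional A" "h \<in> extensional B" using K Y gh by auto
      show "?f \<in> extensional (A \<union> B)" using ext by (auto simp: extensional_def)
      have "restrict ?f A = g" using ext by (auto simp: extensional_def fun_eq_iff)
      moreover have "restrict ?f B = h" using ext AB by (auto simp: extensional_def fun_eq_iff)
      ultimately show "restrict ?f A \<in> K" "restrict ?f B \<in> Y" using gh by auto
    qed
  next
    fix f assume "f \<in> ?Z"
    then show "(case (restrict f A, restrict f B) of (g, h) \<Rightarrow> \<lambda>x. if x \<in> A then g x else h x) = f"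
      by (auto simp: extensional_def fun_eq_iff)
  next
    fix p assume "p \<in> K \<times> Y"
    then obtain g h where p: "p = (g, h)" "g \<in> K" "h \<in> Y" by auto
    then have "g \<in> extensional A" "h \<in> extensional B" using K Y by auto
    then show "(restrict (case p of (g, h) \<Rightarrow> \<lambda>x. if x \<in> A then g x else h x) A,
        restrict (case p of (g, h) \<Rightarrow> \<lambda>x. if x \<in> A then g x else h x) B) = p"
      using AB p(1) by (auto simp: extensional_def fun_eq_iff)
  qed auto
  then show ?thesis by (simp add: bij_betw_same_card card_cartesian_product)
qed

lemma forests_restrict:
  assumes "f \<in> forests N A" "B \<subseteq> A" "\<And>b. b \<in> B \<Longrightarrow> f b \<in> M b"
  shows "restrict f B \<in> forests M B"
proof (rule forestsI)
  fix C assume C: "C \<subseteq> B" "restrict f B ` C \<subseteq> C"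
  then have "f ` C \<subseteq> C" by (auto simp: image_subset_iff subset_iff)
  then show "C = {}" using forests_no_invariant[OF assms(1), of C] C assms(2) by auto
qed (use assms in auto)

text \<open>
  If no vertex of one part has a neighbour in the other, an invariant subset meets each part in an
  invariant subset.
\<close>

lemma card_forests_disjoint_union:
  assumes AB: "A \<inter> B = {}" and NA: "\<And>a. a \<in> A \<Longrightarrow> N a \<inter> B = {}"
    and NB: "\<And>b. b \<in> B \<Longrightarrow> N b \<inter> A = {}"
  shows "card (forests N (A \<union> B)) = card (forests N A) * card (forests N B)"
proof -
  have "forests N (A \<union> B) =
    {f \<in> extensional (A \<union> B). restrict f A \<in> forests N A \<and> restrict f B \<in> forests N B}"
  proof (intro equalityI subsetI)
    fix f assume f: "f \<in> forests N (A \<union> B)"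
    then show "f \<in> {f \<in> extensional (A \<union> B). restrict f A \<in> forests N A \<and> restrict f B \<in> forests N B}"
      using forestsD[OF f] by (auto intro!: forests_restrict[OF f])
  next
    fix f assume "f \<in> {f \<in> extensional (A \<union> B). restrict f A \<in> forests N A \<and> restrict f B \<in> forests N B}"
    then have f: "f \<in> extensional (A \<union> B)" "restrict f A \<in> forests N A" "restrict f B \<in> forests N B" by auto
    have fA: "f a \<in> N a" if "a \<in> A" for a using forestsD(2)[OF f(2) that] that by simp
    have fB: "f a \<in> N a" if "a \<in> B" for a using forestsD(2)[OF f(3) that] that by simp
    show "f \<in> forests N (A \<union> B)"
    proof (rule forestsI)
      fix C assume C: "C \<subseteq> A \<union> B" "f ` C \<subseteq> C"
      have "restrict f A ` (C \<inter> A) \<subseteq> C \<inter> A"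
      proof
        fix z assume "z \<in> restrict f A ` (C \<inter> A)"
        then obtain a where "a \<in> C" "a \<in> A" "z = f a" by auto
        then show "z \<in> C \<inter> A" using C fA[of a] NA[of a] by blast
      qed
      then have "C \<inter> A = {}" using forests_no_invariant[OF f(2), of "C \<inter> A"] by auto
      moreover have "restrict f B ` (C \<inter> B) \<subseteq> C \<inter> B"
      proof
        fix z assume "z \<in> restrict f B ` (C \<inter> B)"
        then obtain a where "a \<in> C" "a \<in> B" "z = f a" by auto
        then show "z \<in> C \<inter> B" using C fB[of a] NB[of a] by blast
      qed
      then have "C \<inter> B = {}" using forests_no_invariant[OF f(3), of "C \<inter> B"] by auto
      ultimately show "C = {}" using C(1) by auto
    qed (use f(1) fA fB in auto)
  qed
  then show ?thesis
    using card_glued_functions[OF AB, of "forests N A" "forests N B"] forestsD(1) by (metis subsetI)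
qed

lemma forests_empty: "forests N {} = {\<lambda>x. undefined}"
  by (auto simp: forests_def)

lemma card_forests_Union:
  assumes "finite P" and "\<And>A B. A \<in> P \<Longrightarrow> B \<in> P \<Longrightarrow> A \<noteq> B \<Longrightarrow> A \<inter> B = {}"
    and "\<And>A a. A \<in> P \<Longrightarrow> a \<in> A \<Longrightarrow> N a \<inter> \<Union>P \<subseteq> A"
  shows "card (forests N (\<Union>P)) = (\<Prod>A\<in>P. card (forests N A))"
  using assms
proof (induction P rule: finite_induct)
  case empty
  then show ?case by (simp add: forests_empty)
next
  case (insert A P)
  have dis: "A \<inter> B = {}" if "B \<in> P" for B using insert.prems(1)[of A B] insert.hyps(2) that by auto
  have "card (forests N (A \<union> \<Union>P)) = card (forests N A) * card (forests N (\<Union>P))"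
  proof (rule card_forests_disjoint_union)
    show "A \<inter> \<Union>P = {}" using dis by auto
    show "N a \<inter> \<Union>P = {}" if "a \<in> A" for a using insert.prems(2)[of A a] that dis by blast
    show "N b \<inter> A = {}" if "b \<in> \<Union>P" for b
    proof -
      from that obtain B where "B \<in> P" "b \<in> B" by auto
      then show ?thesis using insert.prems(2)[of B b] dis[of B] by blast
    qed
  qed
  moreover have "card (forests N (\<Union>P)) = (\<Prod>A\<in>P. card (forests N A))"
  proof (rule insert.IH)
    show "B \<inter> C = {}" if "B \<in> P" "C \<in> P" "B \<noteq> C" for B C using insert.prems(1) that by auto
    show "N a \<inter> \<Union>P \<subseteq> B" if "B \<in> P" "a \<in> B" for B a using insert.prems(2)[of B a] that by auto
  qed
  ultimately show ?case using insert.hyps by simp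
qed

text \<open>
  The binomial theorem, and what one obtains from it by applying \<open>k * d/dk\<close>. The second equation is
  multiplied by \<open>k + n\<close> to avoid the exponent \<open>card A - 1\<close>.
\<close>

lemma sum_weights_over_subsets:
  fixes k n :: nat
  assumes "finite A"
  shows "(\<Sum>S\<in>Pow A. k ^ card S * n ^ card (A - S)) = (k + n) ^ card A"
    and "(\<Sum>S\<in>Pow A. card S * (k ^ card S * n ^ card (A - S))) * (k + n) = card A * k * (k + n) ^ card A"
proof -
  have 1: "(\<Sum>S\<in>Pow A. k ^ card S * n ^ card (A - S)) = (k + n) ^ card A" if "finite A" for A :: "'a set"
    using prod_add[OF that, of "\<lambda>_. k" "\<lambda>_. n"] by simp
  then show "(\<Sum>S\<in>Pow A. k ^ card S * n ^ card (A - S)) = (k + n) ^ card A" using assms .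
  show "(\<Sum>S\<in>Pow A. card S * (k ^ card S * n ^ card (A - S))) * (k + n) = card A * k * (k + n) ^ card A"
    using assms
  proof (induction A rule: finite_induct)
    case (insert x A)
    let ?w = "\<lambda>A S. k ^ card S * n ^ card (A - S)"
    have x: "x \<notin> S" "finite S" if "S \<in> Pow A" for S using that insert.hyps by (auto intro: finite_subset)
    have inj: "inj_on (insert x) (Pow A)" using x(1) by (metis PowD inj_onI insert_ident)
    have "(\<Sum>S\<in>Pow (insert x A). card S * ?w (insert x A) S) =
        (\<Sum>S\<in>Pow A. card S * ?w (insert x A) S) + (\<Sum>S\<in>insert x ` Pow A. card S * ?w (insert x A) S)"
      unfolding Pow_insert by (rule sum.union_disjoint) (use insert.hyps in auto)
    also have "(\<Sum>S\<in>Pow A. card S * ?w (insert x A) S) = n * (\<Sum>S\<in>Pow A. card S * ?w A S)"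
      unfolding sum_distrib_left
    proof (rule sum.cong[OF refl])
      fix S assume S: "S \<in> Pow A"
      have "insert x A - S = insert x (A - S)" using x(1)[OF S] by auto
      then show "card S * ?w (insert x A) S = n * (card S * ?w A S)"
        using insert.hyps by simp
    qed
    also have "(\<Sum>S\<in>insert x ` Pow A. card S * ?w (insert x A) S) =
        (\<Sum>S\<in>Pow A. k * (card S * ?w A S) + k * ?w A S)"
      unfolding sum.reindex[OF inj] o_def
    proof (rule sum.cong[OF refl])
      fix S assume S: "S \<in> Pow A"
      have "insert x A - insert x S = A - S" using insert.hyps by auto
      then show "card (insert x S) * ?w (insert x A) (insert x S) = k * (card S * ?w A S) + k * ?w A S"
        using x[OF S] by (simp add: algebra_simps)
    qed
    also have "\<dots> = k * (\<Sum>S\<in>Pow A. card S * ?w A S) + k * (k + n) ^ card A"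
      by (simp add: sum.distrib sum_distrib_left[symmetric] 1[OF insert.hyps(1)])
    finally have "(\<Sum>S\<in>Pow (insert x A). card S * ?w (insert x A) S) * (k + n) =
        (n + k) * ((\<Sum>S\<in>Pow A. card S * ?w A S) * (k + n)) + k * (k + n) ^ Suc (card A)"
      by (simp add: algebra_simps)
    then show ?case unfolding insert.IH using insert.hyps by (simp add: algebra_simps)
  qed simp
qed

text \<open>
  Sort the forests by the set \<open>S\<close> of vertices whose parent is a root. The remaining vertices carry a
  forest whose roots are the elements of \<open>S\<close>.
\<close>

lemma card_complete_forests_by_layer:
  assumes A: "finite A" and R: "finite R" "A \<inter> R = {}"
  shows "card (forests (\<lambda>_. A \<union> R) A) =
    (\<Sum>S\<in>Pow A. card R ^ card S * card (forests (\<lambda>_. A) (A - S)))"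
proof -
  let ?F = "forests (\<lambda>_. A \<union> R) A"
  let ?L = "\<lambda>S. {f \<in> ?F. {a \<in> A. f a \<in> R} = S}"
  have "?F = (\<Union>S\<in>Pow A. ?L S)"
  proof (rule equalityI; rule subsetI)
    fix f assume f: "f \<in> ?F"
    show "f \<in> (\<Union>S\<in>Pow A. ?L S)"
      by (rule UN_I[of "{a \<in> A. f a \<in> R}"]) (use f in simp_all)
  next
    fix f assume "f \<in> (\<Union>S\<in>Pow A. ?L S)"
    then show "f \<in> ?F" by (elim UN_E) simp
  qed
  then have "card ?F = card (\<Union>S\<in>Pow A. ?L S)" by (rule arg_cong)
  also have "\<dots> = (\<Sum>S\<in>Pow A. card (?L S))"
  proof (rule card_UN_disjoint)
    show "\<forall>S\<in>Pow A. finite (?L S)" using A R finite_forests[of A "\<lambda>_. A \<union> R"] by simp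
    show "\<forall>S\<in>Pow A. \<forall>S'\<in>Pow A. S \<noteq> S' \<longrightarrow> ?L S \<inter> ?L S' = {}" by blast
  qed (use A in simp)
  also have "\<dots> = (\<Sum>S\<in>Pow A. card R ^ card S * card (forests (\<lambda>_. A) (A - S)))"
  proof (rule sum.cong[OF refl])
    fix S assume "S \<in> Pow A"
    then have S: "S \<subseteq> A" "finite S" using A by (auto intro: finite_subset)
    then have A_eq: "S \<union> (A - S) = A" by auto
    have "?L S = {f \<in> extensional (S \<union> (A - S)).
        restrict f S \<in> Pi\<^sub>E S (\<lambda>_. R) \<and> restrict f (A - S) \<in> forests (\<lambda>_. A) (A - S)}" (is "_ = ?Z")
    proof (intro equalityI subsetI)
      fix f assume "f \<in> ?L S"
      then have f: "f \<in> ?F" "{a \<in> A. f a \<in> R} = S" by auto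
      have "restrict f (A - S) \<in> forests (\<lambda>_. A) (A - S)"
        by (rule forests_restrict[OF f(1)]) (use forestsD(2)[OF f(1)] f(2) in auto)
      moreover have "restrict f S \<in> Pi\<^sub>E S (\<lambda>_. R)" using f(2) by auto
      ultimately show "f \<in> ?Z" using forestsD(1)[OF f(1)] A_eq by auto
    next
      fix f assume "f \<in> ?Z"
      then have f: "f \<in> extensional A" "restrict f S \<in> Pi\<^sub>E S (\<lambda>_. R)"
        "restrict f (A - S) \<in> forests (\<lambda>_. A) (A - S)" using A_eq by auto
      have fS: "f a \<in> R" if "a \<in> S" for a using f(2) that by (auto simp: PiE_iff)
      have fA: "f a \<in> A" if "a \<in> A - S" for a using forestsD(2)[OF f(3) that] that by simp
      have "f \<in> ?F"
      proof (rule forestsI)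
        fix B assume B: "B \<subseteq> A" "f ` B \<subseteq> B"
        then have "B \<subseteq> A - S" using fS R by blast
        moreover from this have "restrict f (A - S) ` B \<subseteq> B" using B by (auto simp: subset_iff image_subset_iff)
        ultimately show "B = {}" using forests_no_invariant[OF f(3)] by blast
      qed (use f fS fA in auto)
      moreover have "{a \<in> A. f a \<in> R} = S" using fS fA R S by blast
      ultimately show "f \<in> ?L S" by auto
    qed
    then have "card (?L S) = card (Pi\<^sub>E S (\<lambda>_. R)) * card (forests (\<lambda>_. A) (A - S))"
      using card_glued_functions[of S "A - S" "Pi\<^sub>E S (\<lambda>_. R)" "forests (\<lambda>_. A) (A - S)"]
      by (auto simp: PiE_def forests_def)
    then show "card (?L S) = card R ^ card S * card (forests (\<lambda>_. A) (A - S))"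
      using S by (simp add: card_PiE)
  qed
  finally show ?thesis .
qed

text \<open>
  Cayley's formula for forests: \<open>n\<close> vertices hang below \<open>k\<close> given roots in \<open>k * (n + k) ^ (n - 1)\<close>
  ways. By induction each summand of the previous lemma is known after multiplication by \<open>n\<close>. The
  extra factor \<open>n + k\<close> in the statement makes the case \<open>n = 0\<close> come out right.
\<close>

theorem card_complete_forests:
  assumes "finite A" "finite R" "A \<inter> R = {}"
  shows "card (forests (\<lambda>_. A \<union> R) A) * (card A + card R) = card R * (card A + card R) ^ card A"
  using assms
proof (induction "card A" arbitrary: A R rule: less_induct)
  case less
  let ?n = "card A" and ?k = "card R"
  show ?case
  proof (cases "A = {}")
    case True
    then show ?thesis by (simp add: forests_empty)
  next
    case False
    then have n: "?n > 0" using less.prems by (simp add: card_gt_0_iff)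
    have *: "card (forests (\<lambda>_. A) (A - S)) * ?n = card S * ?n ^ card (A - S)" if S: "S \<in> Pow A" for S
    proof (cases "S = {}")
      case True
      have "forests (\<lambda>_. A) A = {}" using False by (auto simp: forests_def PiE_iff image_subset_iff)
      then show ?thesis using True by simp
    next
      case False
      have fin: "finite S" "finite (A - S)" using S less.prems by (auto intro: finite_subset)
      have cd: "card (A - S) + card S = ?n"
        using S less.prems fin by (simp add: card_Diff_subset card_mono)
      moreover have "card S > 0" using False fin by (simp add: card_gt_0_iff)
      ultimately have "card (A - S) < ?n" by linarith
      from less.hyps[OF this fin(2) fin(1)] show ?thesis
        using cd S by (simp add: Un_absorb2 Diff_Int_distrib2 inf_commute)
    qed
    have "card (forests (\<lambda>_. A \<union> R) A) * ?n =
        (\<Sum>S\<in>Pow A. ?k ^ card S * (card (forests (\<lambda>_. A) (A - S)) * ?n))"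
      unfolding card_complete_forests_by_layer[OF less.prems] by (simp add: sum_distrib_right mult.assoc)
    also have "\<dots> = (\<Sum>S\<in>Pow A. card S * (?k ^ card S * ?n ^ card (A - S)))"
      by (rule sum.cong[OF refl]) (simp add: *)
    finally have "card (forests (\<lambda>_. A \<union> R) A) * ?n * (?k + ?n) = ?n * ?k * (?k + ?n) ^ ?n"
      using sum_weights_over_subsets(2)[OF less.prems(1)] by simp
    then have "?n * (card (forests (\<lambda>_. A \<union> R) A) * (?n + ?k)) = ?n * (?k * (?n + ?k) ^ ?n)"
      by (simp add: ac_simps)
    then show ?thesis using n by (metis mult_left_cancel neq0_conv)
  qed
qed

corollary card_forests_clique:
  assumes "finite A" "A \<noteq> {}" "r \<notin> A"
  shows "card (forests (\<lambda>_. insert r A) A) = (card A + 1) ^ (card A - 1)"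
proof -
  obtain m where m: "card A = Suc m" using assms by (cases "card A") auto
  have "card (forests (\<lambda>_. insert r A) A) * (card A + 1) = (card A + 1) ^ card A"
    using card_complete_forests[of A "{r}"] assms by simp
  then have "card (forests (\<lambda>_. insert r A) A) * Suc (Suc m) = Suc (Suc m) ^ m * Suc (Suc m)"
    by (simp add: m mult.commute del: mult_Suc mult_Suc_right)
  then show ?thesis by (simp add: m del: mult_Suc mult_Suc_right)
qed

lemma even_card_if_free_involution:
  assumes "finite K" and h: "\<And>x. x \<in> K \<Longrightarrow> h x \<in> K" "\<And>x. x \<in> K \<Longrightarrow> h (h x) = x" "\<And>x. x \<in> K \<Longrightarrow> h x \<noteq> x"
  shows "even (card K)"
proof -
  let ?C = "(\<lambda>x. {x, h x}) ` K"
  have U: "\<Union>?C = K" using h by auto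
  have "2 dvd card (\<Union>?C)"
  proof (rule dvd_partition)
    show "finite (\<Union>?C)" using U assms(1) by simp
    show "\<forall>c\<in>?C. 2 dvd card c"
    proof
      fix c assume "c \<in> ?C"
      then obtain x where "x \<in> K" "c = {x, h x}" by auto
      then have "card c = 2" using h(3)[of x] by simp
      then show "2 dvd card c" by simp
    qed
    show "\<forall>c1\<in>?C. \<forall>c2\<in>?C. c1 \<noteq> c2 \<longrightarrow> c1 \<inter> c2 = {}"
    proof -
      have "c = {z, h z}" if "c \<in> ?C" "z \<in> c" for c z
      proof -
        from that(1) obtain x where x: "x \<in> K" "c = {x, h x}" by auto
        then have "z = x \<or> z = h x" using that(2) by simp
        then show ?thesis using x h(2)[OF x(1)] by auto
      qed
      then show ?thesis by blast
    qed
  qed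
  then show ?thesis using U by simp
qed

text \<open>
  Exchanging the twins \<open>x\<close> and \<open>y\<close> is an involution on the forests. In a forest that it fixes, no vertex
  has \<open>x\<close> or \<open>y\<close> as parent, and \<open>x\<close> and \<open>y\<close> have the same parent; this common parent can be any of an
  even number of vertices, independently of the rest of the forest.
\<close>

lemma even_card_forests_of_twins:
  assumes A: "finite A" "\<And>a. a \<in> A \<Longrightarrow> finite (N a)" and xy: "x \<in> A" "y \<in> A" "x \<noteq> y"
    and twins: "N x - {x, y} = N y - {x, y}" "y \<in> N x \<longleftrightarrow> x \<in> N y"
      "\<And>v. v \<in> A - {x, y} \<Longrightarrow> x \<in> N v \<longleftrightarrow> y \<in> N v"
    and ev: "even (card (N x - {x, y}))"
  shows "even (card (forests N A))"
proof -
  define \<sigma> where "\<sigma> = Transposition.transpose x y"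
  have \<sigma>: "\<sigma> x = y" "\<sigma> y = x" "\<sigma> (\<sigma> v) = v" "v \<noteq> x \<Longrightarrow> v \<noteq> y \<Longrightarrow> \<sigma> v = v" for v by (auto simp: \<sigma>_def)
  have \<sigma>A: "\<sigma> v \<in> A" if "v \<in> A" for v using that xy \<sigma> by (cases "v = x \<or> v = y") auto
  define \<phi> where "\<phi> f = restrict (\<lambda>v. \<sigma> (f (\<sigma> v))) A" for f
  let ?F = "forests N A"
  have \<phi>F: "\<phi> f \<in> ?F" if f: "f \<in> ?F" for f
  proof (rule forestsI)
    show "\<phi> f \<in> extensional A" by (simp add: \<phi>_def)
    show "\<phi> f v \<in> N v" if v: "v \<in> A" for v
    proof -
      have "\<sigma> (f (\<sigma> v)) \<in> N v" if w: "f (\<sigma> v) \<in> N (\<sigma> v)" "f (\<sigma> v) \<noteq> \<sigma> v"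
        using w twins(1,2) twins(3)[of v] v \<sigma>
        by (cases "v = x"; cases "v = y"; cases "f (\<sigma> v) = x"; cases "f (\<sigma> v) = y") auto
      then show ?thesis
        using forestsD(2)[OF f \<sigma>A[OF v]] forests_no_fixpoint[OF f \<sigma>A[OF v]] v by (simp add: \<phi>_def)
    qed
    fix B assume B: "B \<subseteq> A" "\<phi> f ` B \<subseteq> B"
    have "f ` (\<sigma> ` B) \<subseteq> \<sigma> ` B"
    proof
      fix w assume "w \<in> f ` (\<sigma> ` B)"
      then obtain b where b: "b \<in> B" "w = f (\<sigma> b)" by auto
      then have "\<sigma> w \<in> B" using B by (auto simp: \<phi>_def image_subset_iff subset_iff)
      then show "w \<in> \<sigma> ` B" using \<sigma>(3)[of w] by (metis imageI)
    qed
    moreover have "\<sigma> ` B \<subseteq> A" using B(1) \<sigma>A by auto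
    ultimately show "B = {}" using forests_no_invariant[OF f, of "\<sigma> ` B"] by auto
  qed
  have \<phi>\<phi>: "\<phi> (\<phi> f) = f" if "f \<in> ?F" for f
    using forestsD(1)[OF that] \<sigma>A by (auto simp: \<phi>_def extensional_def fun_eq_iff \<sigma>(3))
  have fin: "finite ?F" using finite_forests A by blast
  have "even (card {f \<in> ?F. \<phi> f \<noteq> f})"
    by (rule even_card_if_free_involution[where h = \<phi>]) (use fin \<phi>F \<phi>\<phi> in auto)
  moreover have "even (card {f \<in> ?F. \<phi> f = f})"
  proof -
    let ?A = "A - {x, y}"
    let ?c = "\<lambda>z. restrict (\<lambda>_. z) {x, y}"
    let ?K = "?c ` (N x - {x, y})" and ?Y = "forests (\<lambda>v. N v - {x, y}) ?A"
    have A_eq: "{x, y} \<union> ?A = A" using xy by auto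
    have "{f \<in> ?F. \<phi> f = f} = {f \<in> extensional ({x, y} \<union> ?A). restrict f {x, y} \<in> ?K \<and> restrict f ?A \<in> ?Y}"
      (is "?L = ?R")
    proof (intro equalityI subsetI)
      fix f assume "f \<in> ?L"
      then have f: "f \<in> ?F" and "\<phi> f = f" by auto
      then have fix1: "\<sigma> (f (\<sigma> v)) = f v" if "v \<in> A" for v using that by (metis \<phi>_def restrict_apply')
      have fv: "f v \<notin> {x, y}" if "v \<in> ?A" for v using fix1[of v] that \<sigma> xy by auto
      have fy: "f y = \<sigma> (f x)" using fix1[of y] xy \<sigma> by auto
      have "f x \<noteq> x" using forests_no_fixpoint[OF f xy(1)] .
      moreover have "f x \<noteq> y"
      proof
        assume "f x = y"
        then have "f ` {x, y} \<subseteq> {x, y}" using fy \<sigma> by auto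
        then show False using forests_no_invariant[OF f, of "{x, y}"] xy by auto
      qed
      ultimately have fx: "f x \<in> N x - {x, y}" "f y = f x"
        using forestsD(2)[OF f xy(1)] fy \<sigma> by auto
      have "restrict f {x, y} = ?c (f x)" using fx(2) by (auto simp: fun_eq_iff)
      moreover have "restrict f ?A \<in> ?Y"
        by (rule forests_restrict[OF f]) (use forestsD(2)[OF f] fv in auto)
      ultimately show "f \<in> ?R" using forestsD(1)[OF f] fx(1) A_eq by auto
    next
      fix f assume "f \<in> ?R"
      then obtain z where f: "f \<in> extensional A" "restrict f {x, y} = ?c z" "z \<in> N x - {x, y}"
        "restrict f ?A \<in> ?Y" using A_eq by auto
      have fxy: "f x = z" "f y = z" using fun_cong[OF f(2), of x] fun_cong[OF f(2), of y] by auto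
      have fv: "f v \<in> N v - {x, y}" if "v \<in> ?A" for v using forestsD(2)[OF f(4) that] that by simp
      have "f \<in> ?F"
      proof (rule forestsI)
        have z: "z \<in> N x" "z \<in> N y" using f(3) twins(1) by blast+
        show "f v \<in> N v" if "v \<in> A" for v
        proof (cases "v \<in> ?A")
          case False
          then show ?thesis using z fxy that by auto
        qed (use fv in auto)
        fix B assume B: "B \<subseteq> A" "f ` B \<subseteq> B"
        have "restrict f ?A ` (B \<inter> ?A) \<subseteq> B \<inter> ?A"
          using B fv by (fastforce simp: image_subset_iff)
        then have "B \<inter> ?A = {}" using forests_no_invariant[OF f(4), of "B \<inter> ?A"] by auto
        then have "B \<subseteq> {x, y}" using B by auto
        show "B = {}"
        proof (rule ccontr)
          assume "B \<noteq> {}"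
          then obtain b where "b \<in> B" "f b = z" using \<open>B \<subseteq> {x, y}\<close> fxy by blast
          then have "z \<in> B" using B(2) by auto
          then show False using \<open>B \<subseteq> {x, y}\<close> f(3) by auto
        qed
      qed (use f in auto)
      moreover have "\<phi> f = f"
      proof (rule extensionalityI[of _ A])
        fix v assume v: "v \<in> A"
        show "\<phi> f v = f v"
        proof (cases "v = x \<or> v = y")
          case True
          then show ?thesis using v fxy \<sigma> f(3) by (auto simp: \<phi>_def)
        next
          case False
          then show ?thesis using v fv[of v] \<sigma> by (auto simp: \<phi>_def)
        qed
      qed (use f in \<open>auto simp: \<phi>_def\<close>)
      ultimately show "f \<in> ?L" by auto
    qed
    moreover have "card ?R = card ?K * card ?Y"
      by (rule card_glued_functions) (auto simp: forests_def PiE_def)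
    moreover have "card ?K = card (N x - {x, y})"
    proof (rule card_image, rule inj_onI)
      fix a b assume "?c a = ?c b"
      from fun_cong[OF this, of x] show "a = b" by simp
    qed
    ultimately show ?thesis using ev by simp
  qed
  moreover have "card ?F = card {f \<in> ?F. \<phi> f \<noteq> f} + card {f \<in> ?F. \<phi> f = f}"
    using fin by (subst card_Un_disjoint[symmetric]) (auto intro: arg_cong[where f = card])
  ultimately show ?thesis by simp
qed

section \<open>Spanning trees of power graphs\<close>

locale finite_group = group +
  assumes finite_carrier [simp, intro]: "finite (carrier G)"
begin

abbreviation cyc :: "'a \<Rightarrow> 'a set" where
  "cyc x \<equiv> generate G {x}"

definition gens :: "'a \<Rightarrow> 'a set" where
  "gens x = {y \<in> carrier G. cyc y = cyc x}"

definition gen_classes :: "'a set set" where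
  "gen_classes = gens ` (carrier G - {\<one>})"

text \<open>
  The closed neighbourhood of \<open>x\<close> in the power graph. A vertex is never its own parent in a forest, so
  closed neighbourhoods give the same forests as open ones.
\<close>

definition comparable :: "'a \<Rightarrow> 'a set" where
  "comparable x = {y \<in> carrier G. cyc x \<subseteq> cyc y \<or> cyc y \<subseteq> cyc x}"

definition elems_of_ord :: "nat \<Rightarrow> 'a set" where
  "elems_of_ord n = {x \<in> carrier G. ord x = n}"

lemma cyc_subset [simp]: "x \<in> carrier G \<Longrightarrow> cyc x \<subseteq> carrier G"
  using generate_incl[of "{x}"] by simp

lemma subgroup_cyc: "x \<in> carrier G \<Longrightarrow> subgroup (cyc x) G"
  by (simp add: generate_is_subgroup)

lemma self_in_cyc [simp]: "x \<in> cyc x"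
  by (simp add: generate.incl)

lemma cyc_subset_iff: "x \<in> carrier G \<Longrightarrow> cyc y \<subseteq> cyc x \<longleftrightarrow> y \<in> cyc x"
  using generate_subgroup_incl[of "{y}" "cyc x"] subgroup_cyc[of x] self_in_cyc[of y] by blast

lemma card_cyc: "x \<in> carrier G \<Longrightarrow> card (cyc x) = ord x"
  by (simp add: generate_pow_card)

lemma finite_cyc [simp]: "x \<in> carrier G \<Longrightarrow> finite (cyc x)"
  using cyc_subset finite_subset by blast

lemma ord_pos: "x \<in> carrier G \<Longrightarrow> 0 < ord x"
  using ord_ge_1[of x] by simp

lemma cyc_one: "cyc \<one> = {\<one>}"
  using generate_one by simp

lemma in_cyc_iff_pow: "x \<in> carrier G \<Longrightarrow> y \<in> cyc x \<longleftrightarrow> (\<exists>k::nat. y = x [^] k)"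
  using generate_pow_on_finite_carrier[of x] by auto

lemma ord_dvd_of_in_cyc:
  assumes "x \<in> carrier G" "y \<in> cyc x" shows "ord y dvd ord x"
proof -
  obtain k :: nat where k: "y = x [^] k" using assms in_cyc_iff_pow by auto
  have "y [^] ord x = (x [^] ord x) [^] k"
    using assms(1) by (simp add: k nat_pow_pow mult.commute del: pow_ord_eq_1)
  then have "y [^] ord x = \<one>" using assms(1) by simp
  then show ?thesis using pow_eq_id[of y] assms(1) k by simp
qed

lemma cyc_eq_of_same_ord:
  assumes "x \<in> carrier G" "y \<in> cyc x" "ord y = ord x" shows "cyc y = cyc x"
proof -
  have y: "y \<in> carrier G" using assms cyc_subset by blast
  show ?thesis
    using card_subset_eq[of "cyc x" "cyc y"] cyc_subset_iff[of x y] assms y by (simp add: card_cyc)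
qed

lemma cyc_inv: assumes "x \<in> carrier G" shows "cyc (inv x) = cyc x"
proof (rule cyc_eq_of_same_ord)
  show "inv x \<in> cyc x" using subgroup.m_inv_closed[OF subgroup_cyc] assms by simp
qed (use assms in simp_all)

lemma kappa_eq_card_forests: "kappa G = card (forests comparable (carrier G - {\<one>}))"
proof -
  let ?P = "power_graph G"
  have "kappa G = card (forests (\<lambda>v. {w. {v, w} \<in> edges ?P}) (carrier G - {\<one>}))"
    unfolding kappa_def
    using card_spanning_trees[of ?P \<one>] by (fastforce simp: power_graph_def simple_ugraph_def)
  also have "forests (\<lambda>v. {w. {v, w} \<in> edges ?P}) (carrier G - {\<one>}) =
      forests (\<lambda>v. comparable v - {v}) (carrier G - {\<one>})"
    by (rule forests_cong) (auto simp: power_graph_def comparable_def doubleton_eq_iff)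
  finally show ?thesis by (simp add: forests_remove_self)
qed

lemma gens_cong: "y \<in> gens x \<Longrightarrow> gens y = gens x"
  by (auto simp: gens_def)

lemma gens_refl: "x \<in> carrier G \<Longrightarrow> x \<in> gens x"
  by (simp add: gens_def)

lemma ord_gens: "x \<in> carrier G \<Longrightarrow> y \<in> gens x \<Longrightarrow> ord y = ord x"
  using card_cyc[of x] card_cyc[of y] by (auto simp: gens_def)

lemma finite_gen_classes [simp]: "finite gen_classes"
  by (simp add: gen_classes_def)

lemma gen_classesD:
  assumes "A \<in> gen_classes"
  shows "finite A" "A \<noteq> {}" "\<one> \<notin> A" "a \<in> A \<Longrightarrow> gens a = A" "A \<subseteq> carrier G"
proof -
  obtain x where x: "x \<in> carrier G" "x \<noteq> \<one>" "A = gens x" using assms by (auto simp: gen_classes_def)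
  show "finite A" "A \<subseteq> carrier G" by (auto simp: x gens_def)
  show "A \<noteq> {}" using gens_refl x by auto
  show "a \<in> A \<Longrightarrow> gens a = A" using gens_cong x by auto
  show "\<one> \<notin> A" using x ord_eq_1[of x] ord_gens[of x \<one>] by auto
qed

lemma gen_classes_disjoint:
  "A \<in> gen_classes \<Longrightarrow> B \<in> gen_classes \<Longrightarrow> A \<noteq> B \<Longrightarrow> A \<inter> B = {}"
  using gen_classesD(4) by blast

lemma Union_gen_classes: "\<Union>gen_classes = carrier G - {\<one>}"
proof
  show "\<Union>gen_classes \<subseteq> carrier G - {\<one>}" using gen_classesD by blast
  show "carrier G - {\<one>} \<subseteq> \<Union>gen_classes" using gens_refl by (auto simp: gen_classes_def)
qed

text \<open>
  Here an element may only have the identity or another generator of the same cyclic subgroup as parent;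
  the classes of generators are then independent cliques.
\<close>

lemma card_forests_in_gens:
  "card (forests (\<lambda>x. insert \<one> (gens x)) (carrier G - {\<one>})) =
    (\<Prod>A\<in>gen_classes. (card A + 1) ^ (card A - 1))"
proof -
  let ?N = "\<lambda>x. insert \<one> (gens x)"
  have "card (forests ?N (\<Union>gen_classes)) = (\<Prod>A\<in>gen_classes. card (forests ?N A))"
    by (rule card_forests_Union) (use gen_classes_disjoint gen_classesD in auto)
  also have "\<dots> = (\<Prod>A\<in>gen_classes. (card A + 1) ^ (card A - 1))"
  proof (rule prod.cong[OF refl])
    fix A assume A: "A \<in> gen_classes"
    have "forests ?N A = forests (\<lambda>_. insert \<one> A) A"
      by (rule forests_cong) (use gen_classesD(4)[OF A] in simp)
    then show "card (forests ?N A) = (card A + 1) ^ (card A - 1)"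
      using card_forests_clique[OF gen_classesD(1-3)[OF A]] by simp
  qed
  finally show ?thesis by (simp add: Union_gen_classes)
qed

lemma one_comparable: "x \<in> carrier G \<Longrightarrow> \<one> \<in> comparable x"
  using subgroup.one_closed[OF subgroup_cyc[of x]] by (simp add: comparable_def cyc_one)

lemma gens_subset_comparable: "x \<in> carrier G \<Longrightarrow> insert \<one> (gens x) \<subseteq> comparable x"
  using one_comparable[of x] by (auto simp: comparable_def gens_def)

lemma finite_comparable [simp]: "finite (comparable x)"
  by (simp add: comparable_def)

theorem kappa_ge_prod: "(\<Prod>A\<in>gen_classes. (card A + 1) ^ (card A - 1)) \<le> kappa G"
  unfolding card_forests_in_gens[symmetric] kappa_eq_card_forests
  by (rule card_mono) (auto intro!: finite_forests forests_mono gens_subset_comparable[THEN subsetD])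

lemma gens_prime_ord:
  assumes x: "x \<in> carrier G" and p: "Factorial_Ring.prime (ord x)"
  shows "insert \<one> (gens x) = cyc x" "card (gens x) = ord x - 1"
proof -
  have "x \<noteq> \<one>" using p by auto
  show eq: "insert \<one> (gens x) = cyc x"
  proof (intro equalityI subsetI)
    fix y assume "y \<in> insert \<one> (gens x)"
    then consider "y = \<one>" | "cyc y = cyc x" by (auto simp: gens_def)
    then show "y \<in> cyc x"
      using subgroup.one_closed[OF subgroup_cyc[OF x]] self_in_cyc[of y] by cases simp_all
  next
    fix y assume y: "y \<in> cyc x"
    then have yc: "y \<in> carrier G" using cyc_subset[OF x] by auto
    have "ord y = 1 \<or> ord y = ord x" using ord_dvd_of_in_cyc[OF x y] p by (auto simp: prime_nat_iff)
    then show "y \<in> insert \<one> (gens x)"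
      using ord_eq_1[OF yc] cyc_eq_of_same_ord[OF x y] yc by (auto simp: gens_def)
  qed
  have "\<one> \<notin> gens x"
  proof
    assume "\<one> \<in> gens x"
    then show False using p unfolding ord_gens[OF x \<open>\<one> \<in> gens x\<close>, symmetric] by simp
  qed
  moreover have "finite (gens x)" by (simp add: gens_def)
  ultimately have "card (cyc x) = card (gens x) + 1" unfolding eq[symmetric] by simp
  then show "card (gens x) = ord x - 1" by (simp add: card_cyc x)
qed

text \<open>
  Distinct cyclic subgroups of prime order are incomparable, so the power graph consists of cliques
  that share only the identity.
\<close>

theorem kappa_eq_prod_if_prime_orders:
  assumes pr: "\<And>x. x \<in> carrier G \<Longrightarrow> x \<noteq> \<one> \<Longrightarrow> Factorial_Ring.prime (ord x)"
  shows "kappa G = (\<Prod>A\<in>gen_classes. (card A + 1) ^ (card A - 1))"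
proof -
  have "comparable x = insert \<one> (gens x)" if x: "x \<in> carrier G - {\<one>}" for x
  proof
    show "comparable x \<subseteq> insert \<one> (gens x)"
    proof
      fix y assume y: "y \<in> comparable x"
      then have yc: "y \<in> carrier G" by (simp add: comparable_def)
      show "y \<in> insert \<one> (gens x)"
      proof (cases "y = \<one>")
        case False
        have "cyc x = cyc y"
        proof (cases "cyc x \<subseteq> cyc y")
          case True
          then have "x \<in> insert \<one> (gens y)" using gens_prime_ord(1)[OF yc pr[OF yc False]] by auto
          then show ?thesis using x by (simp add: gens_def)
        next
          case notsub: False
          then have "cyc y \<subseteq> cyc x" using y by (auto simp: comparable_def)
          then have "y \<in> insert \<one> (gens x)" using gens_prime_ord(1)[of x] pr[of x] x by auto
          then show ?thesis using False by (simp add: gens_def)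
        qed
        then show ?thesis using yc by (simp add: gens_def)
      qed simp
    qed
  qed (use gens_subset_comparable x in auto)
  then have "forests comparable (carrier G - {\<one>}) = forests (\<lambda>x. insert \<one> (gens x)) (carrier G - {\<one>})"
    by (rule forests_cong)
  then show ?thesis by (simp add: kappa_eq_card_forests card_forests_in_gens)
qed

lemma inv_eq_self_iff: "x \<in> carrier G \<Longrightarrow> inv x = x \<longleftrightarrow> ord x dvd 2"
proof -
  assume x: "x \<in> carrier G"
  have "inv x = x \<longleftrightarrow> x \<otimes> x = \<one>" using x by (metis inv_equality r_inv)
  also have "x \<otimes> x = x [^] (2::nat)" using x by (simp add: numeral_2_eq_2)
  finally show ?thesis using pow_eq_id[OF x] by simp
qed

text \<open>
  The elements \<open>x\<close> and \<open>inv x\<close> are twins. Their closed neighbourhood consists of the cyclic subgroup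
  of \<open>x\<close>, of even order, and of elements generating larger cyclic subgroups; the latter come in pairs
  of distinct mutually inverse elements.
\<close>

theorem even_kappa_if_even_ord:
  assumes x: "x \<in> carrier G" "even (ord x)" "ord x \<noteq> 2"
  shows "even (kappa G)"
proof -
  have ix: "inv x \<in> carrier G" "cyc (inv x) = cyc x" using x cyc_inv by auto
  have "x \<noteq> \<one>" using x(2) by auto
  have ne: "inv x \<noteq> x"
    using inv_eq_self_iff[OF x(1)] x(2,3) dvd_antisym[of "ord x" 2] by auto
  let ?U = "{y \<in> carrier G. cyc x \<subset> cyc y}"
  have "even (card ?U)"
  proof (rule even_card_if_free_involution[where h = "\<lambda>y. inv y"])
    fix y assume y: "y \<in> ?U"
    have "card (cyc x) < card (cyc y)" using y psubset_card_mono[of "cyc y" "cyc x"] by simp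
    moreover have "ord x \<ge> 2" using x(2) ord_pos[OF x(1)] by (auto elim: evenE)
    ultimately have "\<not> ord y dvd 2" using y x(1) by (auto simp: card_cyc dest: dvd_imp_le)
    then show "inv y \<noteq> y" using inv_eq_self_iff[of y] y by auto
  qed (auto simp: cyc_inv)
  moreover have "comparable x = cyc x \<union> ?U"
    using cyc_subset[OF x(1), THEN subsetD] cyc_subset_iff[OF x(1)] by (auto simp: comparable_def)
  moreover have "cyc x \<inter> ?U = {}" using cyc_subset_iff[OF x(1)] by auto
  ultimately have "even (card (comparable x))"
    using x by (simp add: card_Un_disjoint card_cyc)
  moreover have "card (comparable x - {x, inv x}) = card (comparable x) - 2"
    using ne x ix by (subst card_Diff_subset) (auto simp: comparable_def)
  ultimately have ev: "even (card (comparable x - {x, inv x}))" by simp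
  have "even (card (forests comparable (carrier G - {\<one>})))"
  proof (rule even_card_forests_of_twins[where x = x and y = "inv x"])
    show "inv x \<in> carrier G - {\<one>}" using ix x(1) \<open>x \<noteq> \<one>\<close> inv_eq_1_iff by auto
    show "x \<in> comparable v \<longleftrightarrow> inv x \<in> comparable v" for v
      using ix x(1) by (simp add: comparable_def)
  qed (use ix x ne ev \<open>x \<noteq> \<one>\<close> in \<open>auto simp: comparable_def\<close>)
  then show ?thesis by (simp add: kappa_eq_card_forests)
qed

text \<open>
  The exponents \<open>\<plusminus>1\<close>, \<open>\<plusminus>2\<close>, \<open>\<plusminus>4\<close> are prime to an odd order, and distinct modulo an odd order that is
  at least 7.
\<close>

lemma card_gens_ge_6:
  assumes x: "x \<in> carrier G" and n: "odd (ord x)" "ord x \<ge> 7"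
  shows "card (gens x) \<ge> 6"
proof -
  let ?n = "ord x"
  let ?K = "{1, 2, 4, ?n - 1, ?n - 2, ?n - 4}"
  have "?n \<noteq> 8" using n by auto
  then consider "?n = 7" | "?n = (?n - 9) + 9" using n by linarith
  then have card: "card ?K = 6"
  proof cases
    case 2
    then obtain m where m: "?n = m + 9" by blast
    have "distinct [1, 2, 4, m + 8, m + 7, m + 5]" by simp
    then show ?thesis unfolding m using distinct_card[of "[1, 2, 4, m + 8, m + 7, m + 5]"] by simp
  qed simp
  have cop: "coprime k ?n" if "k \<in> ?K" for k
  proof -
    have c: "coprime (1::nat) ?n" "coprime 2 ?n" "coprime (2^2) ?n"
      using n by (simp_all only: coprime_power_left_iff coprime_left_2_iff_odd coprime_1_left) simp_all
    have "coprime (?n - j) ?n" if "coprime j ?n" "j \<le> ?n" for j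
      using that by (metis coprime_iff_gcd_eq_1 gcd_diff2_nat gcd.commute coprime_commute)
    then show ?thesis using c that n by auto
  qed
  have "(\<lambda>k. x [^] k) ` ?K \<subseteq> gens x"
  proof
    fix y assume "y \<in> (\<lambda>k. x [^] k) ` ?K"
    then obtain k where k: "k \<in> ?K" "y = x [^] k" by blast
    then have "ord y = ord x" using pow_ord_eq_ord_iff[of x k] cop x by auto
    then show "y \<in> gens x"
      using cyc_eq_of_same_ord[of x y] in_cyc_iff_pow[of x y] k x by (auto simp: gens_def)
  qed
  moreover have "inj_on (\<lambda>k. x [^] k) ?K"
    by (rule inj_on_subset[OF ord_inj[OF x]]) (use n in auto)
  moreover have "finite (gens x)" by (simp add: gens_def)
  ultimately show ?thesis using card card_mono[of "gens x" "(\<lambda>k. x [^] k) ` ?K"] card_image by metis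
qed

lemma kappa_ge_of_large_classes:
  assumes n: "odd n" "n \<ge> 7"
  shows "7 ^ (5 * card (gens ` elems_of_ord n)) \<le> kappa G"
proof -
  let ?C = "gens ` elems_of_ord n" and ?w = "\<lambda>A. (card A + 1) ^ (card A - 1) :: nat"
  have "7 ^ (5 * card ?C) = (\<Prod>A\<in>?C. 7 ^ 5)" by (simp add: power_mult)
  also have "\<dots> \<le> (\<Prod>A\<in>?C. ?w A)"
  proof (rule prod_mono, intro conjI)
    fix A assume "A \<in> ?C"
    then obtain x where "x \<in> carrier G" "ord x = n" "A = gens x" by (auto simp: elems_of_ord_def)
    then have A: "6 \<le> card A" using card_gens_ge_6 n by auto
    have "(7::nat) ^ 5 \<le> 7 ^ (card A - 1)" using A by (intro power_increasing) auto
    also have "\<dots> \<le> ?w A" using A by (intro power_mono) auto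
    finally show "7 ^ 5 \<le> ?w A" .
  qed simp
  also have "\<dots> \<le> (\<Prod>A\<in>gen_classes. ?w A)"
  proof (rule dvd_imp_le)
    have "x \<noteq> \<one>" if "x \<in> elems_of_ord n" for x using that n by (auto simp: elems_of_ord_def)
    then have "?C \<subseteq> gen_classes" unfolding gen_classes_def by (auto simp: elems_of_ord_def)
    then show "prod ?w ?C dvd prod ?w gen_classes" by (intro prod_dvd_prod_subset) auto
    show "0 < prod ?w gen_classes" by (simp add: prod_pos)
  qed
  also have "\<dots> \<le> kappa G" by (rule kappa_ge_prod)
  finally show ?thesis .
qed

lemma card_elems_of_prime_ord:
  assumes p: "Factorial_Ring.prime p"
    and pr: "\<And>x. x \<in> carrier G \<Longrightarrow> x \<noteq> \<one> \<Longrightarrow> Factorial_Ring.prime (ord x)"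
  shows "(p - 1) * card {A \<in> gen_classes. card A = p - 1} = card (elems_of_ord p)"
proof -
  let ?C = "{A \<in> gen_classes. card A = p - 1}"
  have "\<Union>?C = elems_of_ord p"
  proof (intro equalityI subsetI)
    fix x assume "x \<in> \<Union>?C"
    then obtain A where A: "A \<in> gen_classes" "card A = p - 1" "x \<in> A" by auto
    then have x: "x \<in> carrier G" "x \<noteq> \<one>" "A = gens x" using gen_classesD[OF A(1)] by auto
    then have "ord x - 1 = p - 1" using gens_prime_ord(2)[of x] pr A(2) by auto
    then have "ord x = p" using prime_gt_0_nat[OF p] ord_pos[OF x(1)] by linarith
    then show "x \<in> elems_of_ord p" using x by (simp add: elems_of_ord_def)
  next
    fix x assume "x \<in> elems_of_ord p"
    then have x: "x \<in> carrier G" "ord x = p" by (auto simp: elems_of_ord_def)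
    then have "x \<noteq> \<one>" using p by auto
    then have "gens x \<in> ?C" using gens_prime_ord(2)[of x] x p by (auto simp: gen_classes_def)
    then show "x \<in> \<Union>?C" using gens_refl x by blast
  qed
  moreover have "(p - 1) * card ?C = card (\<Union>?C)"
    by (rule card_partition) (use gen_classesD(5) gen_classes_disjoint in \<open>auto intro: finite_subset[OF _ finite_carrier]\<close>)
  ultimately show ?thesis by simp
qed

text \<open>
  Elements of order 3 form \<open>c3\<close> classes of size 2, each contributing 3 to the product; elements of
  order 5 form \<open>c5\<close> classes of size 4, each contributing \<open>5 ^ 3\<close>; involutions contribute 1.
\<close>

theorem kappa_if_orders_2_3_5:
  assumes ords: "\<And>x. x \<in> carrier G \<Longrightarrow> ord x \<in> {1, 2, 3, 5}"
  obtains c3 c5 where "kappa G = 3 ^ c3 * 5 ^ (3 * c5)"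
    "card (elems_of_ord 3) = 2 * c3" "card (elems_of_ord 5) = 4 * c5"
proof
  let ?C = "\<lambda>p. {A \<in> gen_classes. card A = p - 1}"
  have pr: "Factorial_Ring.prime (ord x)" if "x \<in> carrier G" "x \<noteq> \<one>" for x
    using ords[OF that(1)] ord_eq_1[OF that(1)] that(2) by auto
  have cards: "card A \<in> {1, 2, 4}" if "A \<in> gen_classes" for A
  proof -
    obtain x where x: "x \<in> carrier G" "x \<noteq> \<one>" "A = gens x" using \<open>A \<in> gen_classes\<close> by (auto simp: gen_classes_def)
    then have "card A = ord x - 1" using gens_prime_ord(2)[OF x(1) pr[OF x(1,2)]] by simp
    moreover have "ord x \<in> {2, 3, 5}" using ords[OF x(1)] ord_eq_1[OF x(1)] x(2) by blast
    ultimately show ?thesis by (elim insertE emptyE) simp_all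
  qed
  let ?w = "\<lambda>A. (card A + 1) ^ (card A - 1) :: nat"
  have "prod ?w gen_classes = prod ?w (?C 2 \<union> (?C 3 \<union> ?C 5))"
    by (rule prod.cong) (use cards in auto)
  also have "\<dots> = prod ?w (?C 2) * (prod ?w (?C 3) * prod ?w (?C 5))"
    by (subst prod.union_disjoint; (subst prod.union_disjoint)?) auto
  also have "\<dots> = 3 ^ card (?C 3) * 5 ^ (3 * card (?C 5))"
    by (simp add: power_mult)
  finally show "kappa G = 3 ^ card (?C 3) * 5 ^ (3 * card (?C 5))"
    using kappa_eq_prod_if_prime_orders[OF pr] by simp
  show "card (elems_of_ord 3) = 2 * card (?C 3)" "card (elems_of_ord 5) = 4 * card (?C 5)"
    using card_elems_of_prime_ord[of 3] card_elems_of_prime_ord[of 5] pr by auto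
qed

end

section \<open>Conjugation\<close>

context group
begin

definition conjugate :: "'a \<Rightarrow> 'a \<Rightarrow> 'a" where
  "conjugate g x = g \<otimes> x \<otimes> inv g"

lemma conjugate_closed [simp]: "g \<in> carrier G \<Longrightarrow> x \<in> carrier G \<Longrightarrow> conjugate g x \<in> carrier G"
  by (simp add: conjugate_def)

lemma conjugate_one [simp]: "x \<in> carrier G \<Longrightarrow> conjugate \<one> x = x" "g \<in> carrier G \<Longrightarrow> conjugate g \<one> = \<one>"
  by (simp_all add: conjugate_def)

lemma conjugate_mult_left:
  "g \<in> carrier G \<Longrightarrow> h \<in> carrier G \<Longrightarrow> x \<in> carrier G \<Longrightarrow> conjugate (g \<otimes> h) x = conjugate g (conjugate h x)"
  by (simp add: conjugate_def inv_mult_group m_assoc)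

lemma conjugate_mult:
  assumes "g \<in> carrier G" "x \<in> carrier G" "y \<in> carrier G"
  shows "conjugate g (x \<otimes> y) = conjugate g x \<otimes> conjugate g y"
proof -
  have "conjugate g x \<otimes> conjugate g y = g \<otimes> x \<otimes> ((inv g \<otimes> g) \<otimes> (y \<otimes> inv g))"
    using assms by (simp only: conjugate_def m_assoc m_closed inv_closed)
  then show ?thesis using assms by (simp add: conjugate_def m_assoc)
qed

lemma conjugate_pow:
  "g \<in> carrier G \<Longrightarrow> x \<in> carrier G \<Longrightarrow> conjugate g (x [^] (n::nat)) = conjugate g x [^] n"
  by (induction n) (simp_all add: conjugate_mult)

lemma conjugate_inv_cancel [simp]:
  assumes "g \<in> carrier G" "x \<in> carrier G"
  shows "conjugate (inv g) (conjugate g x) = x" "conjugate g (conjugate (inv g) x) = x"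
  using assms by (simp_all add: conjugate_mult_left[symmetric])

lemma conjugate_eq_one_iff: "g \<in> carrier G \<Longrightarrow> x \<in> carrier G \<Longrightarrow> conjugate g x = \<one> \<longleftrightarrow> x = \<one>"
  by (metis conjugate_inv_cancel(1) conjugate_one(2) inv_closed)

lemma conjugate_inj: "g \<in> carrier G \<Longrightarrow> x \<in> carrier G \<Longrightarrow> y \<in> carrier G \<Longrightarrow> conjugate g x = conjugate g y \<longleftrightarrow> x = y"
  by (metis conjugate_inv_cancel(1))

lemma ord_conj [simp]:
  assumes "g \<in> carrier G" "x \<in> carrier G" shows "ord (conjugate g x) = ord x"
proof -
  have "\<forall>n. conjugate g x [^] (n::nat) = \<one> \<longleftrightarrow> ord x dvd n"
    using assms conjugate_pow[of g x, symmetric] by (simp add: conjugate_eq_one_iff pow_eq_id)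
  then show ?thesis using ord_unique[of "conjugate g x" "ord x"] assms by simp
qed

lemma conjugate_eq_self_iff:
  assumes "g \<in> carrier G" "x \<in> carrier G" shows "conjugate g x = x \<longleftrightarrow> g \<otimes> x = x \<otimes> g"
  using assms unfolding conjugate_def by (metis inv_solve_right m_closed)

lemma conjugate_image_mult:
  assumes "g \<in> carrier G" "h \<in> carrier G" "A \<subseteq> carrier G"
  shows "conjugate (g \<otimes> h) ` A = conjugate g ` conjugate h ` A"
  unfolding image_image using assms conjugate_mult_left by (intro image_cong) auto

lemma conjugate_image_inv:
  assumes "g \<in> carrier G" "A \<subseteq> carrier G"
  shows "conjugate (inv g) ` conjugate g ` A = A" "conjugate g ` conjugate (inv g) ` A = A"
  unfolding image_image using assms by (auto simp: subset_iff image_iff)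

text \<open>
  This is the kernel of the action of the group on the family by conjugation.
\<close>

lemma normal_stabilizer_of_family:
  assumes sub: "\<And>A. A \<in> E \<Longrightarrow> A \<subseteq> carrier G"
    and inv: "\<And>g A. g \<in> carrier G \<Longrightarrow> A \<in> E \<Longrightarrow> conjugate g ` A \<in> E"
  shows "{g \<in> carrier G. \<forall>A\<in>E. conjugate g ` A = A} \<lhd> G" (is "?N \<lhd> G")
proof -
  note comp = conjugate_image_mult[OF _ _ sub] and cancel = conjugate_image_inv[OF _ sub]
  have sg: "subgroup ?N G"
  proof (rule subgroupI)
    have "\<one> \<in> ?N" using sub by (auto simp: subset_iff image_iff)
    then show "?N \<noteq> {}" by blast
  next
    fix g assume g: "g \<in> ?N"
    then show "inv g \<in> ?N" using cancel(1)[of g] by auto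
  next
    fix g h assume "g \<in> ?N" "h \<in> ?N"
    then show "g \<otimes> h \<in> ?N" using comp[of g h] by auto
  qed auto
  show ?thesis unfolding normal_inv_iff
  proof (intro conjI ballI)
    fix x h assume x: "x \<in> carrier G" and h: "h \<in> ?N"
    have "conjugate (x \<otimes> h \<otimes> inv x) ` A = A" if A: "A \<in> E" for A
    proof -
      have A': "conjugate (inv x) ` A \<in> E" using inv x A by simp
      have "conjugate (x \<otimes> h \<otimes> inv x) ` A = conjugate x ` conjugate h ` conjugate (inv x) ` A"
        using comp[of "x \<otimes> h" "inv x" A] comp[of x h "conjugate (inv x) ` A"] x h A A' by simp
      also have "conjugate h ` conjugate (inv x) ` A = conjugate (inv x) ` A" using h A' by blast
      also have "conjugate x ` \<dots> = A" using cancel(2) x A by simp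
      finally show ?thesis .
    qed
    then show "x \<otimes> h \<otimes> inv x \<in> ?N" using x h by simp
  qed (rule sg)
qed

text \<open>
  In a permutation of at most 4 points every cycle has length 1, 2, 3 or 4, hence a length dividing 12.
\<close>

lemma pow_12_fixes_few:
  assumes fin: "finite E" "card E \<le> 4" and sub: "\<And>A. A \<in> E \<Longrightarrow> A \<subseteq> carrier G"
    and inv: "\<And>g A. g \<in> carrier G \<Longrightarrow> A \<in> E \<Longrightarrow> conjugate g ` A \<in> E"
    and x: "x \<in> carrier G" and A: "A \<in> E"
  shows "conjugate (x [^] (12::nat)) ` A = A"
proof -
  note comp = conjugate_image_mult[OF _ _ sub]
  have pow: "conjugate (h [^] (k::nat)) ` B = B" if "h \<in> carrier G" "conjugate h ` B = B" "B \<in> E" for h k B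
  proof (induction k)
    case 0
    have "conjugate \<one> ` B = id ` B" using sub[OF that(3)] by (intro image_cong) auto
    then show ?case by simp
  next
    case (Suc k)
    then show ?case using comp[of "h [^] k" h B] that by simp
  qed
  have "\<not> inj_on (\<lambda>k::nat. conjugate (x [^] k) ` A) {0..4}"
  proof
    assume "inj_on (\<lambda>k::nat. conjugate (x [^] k) ` A) {0..4}"
    then have "card {0..4::nat} \<le> card E" by (rule card_inj_on_le) (use inv x A fin in auto)
    then show False using fin by simp
  qed
  then obtain i j :: nat where ij: "i < j" "j \<le> 4" "conjugate (x [^] i) ` A = conjugate (x [^] j) ` A"
    unfolding inj_on_def by (metis atLeastAtMost_iff linorder_neqE_nat)
  define d where "d = j - i"
  have d: "d \<in> {1, 2, 3, 4}" "j = i + d" using ij by (auto simp: d_def)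
  have Ai: "conjugate (x [^] i) ` A \<in> E" using inv x A by simp
  have "conjugate (x [^] d) ` A = A"
  proof -
    note cancel = conjugate_image_inv(1)[OF nat_pow_closed[OF x] sub]
    have "conjugate (x [^] j) ` A = conjugate (x [^] i) ` conjugate (x [^] d) ` A"
      using comp[of "x [^] i" "x [^] d" A] x A d by (simp add: nat_pow_mult)
    then have "conjugate (inv (x [^] i)) ` conjugate (x [^] i) ` A = conjugate (inv (x [^] i)) ` conjugate (x [^] i) ` conjugate (x [^] d) ` A"
      using ij(3) by simp
    then show ?thesis using cancel[OF A] cancel[of "conjugate (x [^] d) ` A"] inv x A by simp
  qed
  moreover obtain e where "12 = d * e" using d(1) that by (auto intro: that[of "12 div d"])
  ultimately show ?thesis using pow[of "x [^] d" A e] x A by (simp add: nat_pow_pow)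
qed

definition centr :: "'a \<Rightarrow> 'a set" where
  "centr g = {h \<in> carrier G. h \<otimes> g = g \<otimes> h}"

definition ccl :: "'a \<Rightarrow> 'a set" where
  "ccl g = (\<lambda>h. conjugate h g) ` carrier G"

lemma subgroup_centr: assumes g: "g \<in> carrier G" shows "subgroup (centr g) G"
proof -
  have eq: "centr g = {h \<in> carrier G. conjugate h g = g}"
    using g conjugate_eq_self_iff by (auto simp: centr_def)
  show ?thesis unfolding eq
  proof (rule subgroupI)
    show "{h \<in> carrier G. conjugate h g = g} \<noteq> {}" using g by (auto intro!: exI[of _ \<one>])
    fix h assume h: "h \<in> {h \<in> carrier G. conjugate h g = g}"
    then show "inv h \<in> {h \<in> carrier G. conjugate h g = g}" using conjugate_inv_cancel(1)[of h g] g by auto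
  next
    fix h k assume "h \<in> {h \<in> carrier G. conjugate h g = g}" "k \<in> {h \<in> carrier G. conjugate h g = g}"
    then show "h \<otimes> k \<in> {h \<in> carrier G. conjugate h g = g}" using g by (simp add: conjugate_mult_left)
  qed auto
qed

lemma card_ccl_mult_centr:
  assumes g: "g \<in> carrier G" and fin: "finite (carrier G)"
  shows "card (ccl g) * card (centr g) = order G"
proof -
  let ?\<phi> = "\<lambda>h. \<lambda>x \<in> carrier G. h \<otimes> x \<otimes> inv h"
  have "orbit G ?\<phi> g = ccl g" using g by (auto simp: orbit_def ccl_def conjugate_def)
  moreover have "stabilizer G ?\<phi> g = centr g"
    using g conjugate_eq_self_iff by (auto simp: stabilizer_def centr_def conjugate_def)
  ultimately show ?thesis
    using group_action.orbit_stabilizer_theorem[OF action_by_conjugation g] by simp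
qed

lemma ccl_disjoint:
  assumes "a \<in> carrier G" "b \<in> carrier G" "ccl a \<inter> ccl b \<noteq> {}" shows "b \<in> ccl a"
proof -
  obtain h k where hk: "h \<in> carrier G" "k \<in> carrier G" "conjugate h a = conjugate k b" using assms(3) by (auto simp: ccl_def)
  then have "conjugate (inv k \<otimes> h) a = b" using assms by (simp add: conjugate_mult_left)
  then show ?thesis using hk by (auto simp: ccl_def)
qed

lemma ccl_eq: assumes "a \<in> carrier G" "b \<in> ccl a" shows "ccl b = ccl a"
proof -
  obtain h where h: "h \<in> carrier G" "b = conjugate h a" using assms by (auto simp: ccl_def)
  show ?thesis
  proof (intro equalityI subsetI)
    fix x assume "x \<in> ccl b"
    then obtain k where "k \<in> carrier G" "x = conjugate k b" by (auto simp: ccl_def)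
    then have "x = conjugate (k \<otimes> h) a" "k \<otimes> h \<in> carrier G" using h assms by (simp_all add: conjugate_mult_left)
    then show "x \<in> ccl a" by (auto simp: ccl_def)
  next
    fix x assume "x \<in> ccl a"
    then obtain k where "k \<in> carrier G" "x = conjugate k a" by (auto simp: ccl_def)
    then have "x = conjugate (k \<otimes> inv h) b" "k \<otimes> inv h \<in> carrier G" using h assms by (simp_all add: conjugate_mult_left)
    then show "x \<in> ccl b" by (auto simp: ccl_def)
  qed
qed

lemma ccl_refl: "a \<in> carrier G \<Longrightarrow> a \<in> ccl a"
  unfolding ccl_def by (rule image_eqI[of _ _ \<one>]) simp_all

lemma card_subgroup_dvd:
  assumes "subgroup H G" "subgroup K G" "H \<subseteq> K" shows "card H dvd card K"
proof -
  interpret K: group "G\<lparr>carrier := K\<rparr>" using assms(2) by (rule subgroup_imp_group)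
  have "subgroup H (G\<lparr>carrier := K\<rparr>)" using subgroup_incl assms by blast
  from K.lagrange[OF this] show ?thesis by (simp add: order_def) (metis dvd_triv_right)
qed

text \<open>
  Cauchy's theorem, stated for subgroups because it is applied to centralizers.
\<close>

lemma cauchy:
  assumes fin: "finite (carrier G)" and K: "subgroup K G" and p: "Factorial_Ring.prime p" "p dvd card K"
  obtains x where "x \<in> K" "ord x = p"
proof -
  interpret K: group "G\<lparr>carrier := K\<rparr>" using K by (rule subgroup_imp_group)
  obtain m where m: "card K = p ^ 1 * m" using p by (auto elim: dvdE)
  have "finite K" using K fin finite_subset subgroup.subset by blast
  then obtain H where H: "subgroup H (G\<lparr>carrier := K\<rparr>)" "card H = p ^ 1"
    using sylow_thm[OF p(1) K.group_axioms, of 1 m] m by (auto simp: order_def)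
  have HG: "subgroup H G" "H \<subseteq> K" using incl_subgroup[OF K H(1)] subgroup.subset[OF H(1)] by auto
  have "\<not> H \<subseteq> {\<one>}"
    using H(2) p(1) card_mono[of "{\<one>}" H] prime_ge_2_nat[OF p(1)] by auto
  then obtain x where x: "x \<in> H" "x \<noteq> \<one>" by auto
  have xc: "x \<in> carrier G" using x HG subgroup.subset by blast
  have "generate G {x} \<subseteq> H" using generate_subgroup_incl[of "{x}" H] HG x by simp
  then have "ord x dvd p"
    using card_subgroup_dvd[OF generate_is_subgroup HG(1), of "{x}"] xc H(2) by (simp add: generate_pow_card)
  then have "ord x = p" using p(1) ord_eq_1[OF xc] x(2) by (auto simp: prime_nat_iff)
  then show ?thesis using that x HG by blast
qed

end

section \<open>Element orders in simple groups\<close>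

lemma prime_power_products_eq:
  assumes "(3::nat) ^ a * 5 ^ b = 3 ^ c * 5 ^ d" shows "a = c \<and> b = d"
proof -
  have *: "a \<le> c \<and> b \<le> d" if "(3::nat) ^ a * 5 ^ b = 3 ^ c * 5 ^ d" for a b c d :: nat
  proof -
    have "coprime (3::nat) 5" by (rule primes_coprime) simp_all
    then have co: "coprime ((3::nat) ^ i) (5 ^ j)" for i j by simp
    have "(3::nat) ^ a dvd 3 ^ c * 5 ^ d" "(5::nat) ^ b dvd 3 ^ c * 5 ^ d"
      using that by (metis dvd_triv_left, metis dvd_triv_right)
    then have "(3::nat) ^ a dvd 3 ^ c" "(5::nat) ^ b dvd 5 ^ d"
      using co by (metis coprime_dvd_mult_left_iff, metis coprime_commute coprime_dvd_mult_right_iff)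
    then show ?thesis by (auto dest!: power_dvd_imp_le)
  qed
  from *[OF assms] *[OF assms[symmetric]] show ?thesis by simp
qed

lemma (in finite_group) conjugate_gens:
  assumes g: "g \<in> carrier G" and x: "x \<in> carrier G" shows "conjugate g ` gens x = gens (conjugate g x)"
proof -
  have *: "conjugate h y \<in> gens (conjugate h z)" if h: "h \<in> carrier G" and z: "z \<in> carrier G" and y: "y \<in> gens z" for h y z
  proof -
    have yc: "y \<in> carrier G" using y by (simp add: gens_def)
    obtain k :: nat where "y = z [^] k" using y in_cyc_iff_pow[OF z] self_in_cyc[of y] by (auto simp: gens_def)
    then have "conjugate h y \<in> cyc (conjugate h z)" using conjugate_pow[OF h z] in_cyc_iff_pow[of "conjugate h z"] h z by auto
    moreover have "ord (conjugate h y) = ord (conjugate h z)" using ord_gens[OF z y] h z yc by simp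
    ultimately show ?thesis using cyc_eq_of_same_ord[of "conjugate h z" "conjugate h y"] h z yc by (simp add: gens_def)
  qed
  show ?thesis
  proof (intro equalityI subsetI)
    fix y assume y: "y \<in> gens (conjugate g x)"
    then have "conjugate (inv g) y \<in> gens x" using *[of "inv g" "conjugate g x" y] g x by simp
    moreover have "y = conjugate g (conjugate (inv g) y)" using y g by (simp add: gens_def)
    ultimately show "y \<in> conjugate g ` gens x" by blast
  qed (use * g x in auto)
qed

locale finite_simple_group = finite_group + simple_group
begin

lemma normal_subgroup_eq_carrier:
  assumes "N \<lhd> G" "x \<in> N" "x \<noteq> \<one>" shows "N = carrier G"
  using no_real_normal_subgroup[OF assms(1)] assms(2,3) by auto

text \<open>
  The twelfth power of \<open>x\<close> fixes all classes of generators of cyclic subgroups of order \<open>n\<close>. It is not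
  the identity because \<open>n\<close> is odd and does not divide 3. So the kernel of the action on these classes is
  the whole group, and the subgroup generated by \<open>x\<close> is normal.
\<close>

lemma cyc_eq_carrier_if_few_classes:
  assumes n: "odd n" "n \<ge> 7" and few: "card (gens ` elems_of_ord n) \<le> 4"
    and x: "x \<in> elems_of_ord n"
  shows "cyc x = carrier G"
proof -
  let ?E = "gens ` elems_of_ord n"
  have xc: "x \<in> carrier G" "ord x = n" using x by (auto simp: elems_of_ord_def)
  have inv: "conjugate g ` A \<in> ?E" if "g \<in> carrier G" "A \<in> ?E" for g A
    using that by (auto simp: elems_of_ord_def conjugate_gens)
  have sub: "A \<subseteq> carrier G" if "A \<in> ?E" for A using that by (auto simp: gens_def)
  have fin: "finite ?E" by (simp add: elems_of_ord_def)
  let ?N = "{g \<in> carrier G. \<forall>A\<in>?E. conjugate g ` A = A}"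
  have "?N = carrier G"
  proof (rule normal_subgroup_eq_carrier)
    show "?N \<lhd> G" by (rule normal_stabilizer_of_family[OF sub inv])
    show "x [^] (12::nat) \<in> ?N" using pow_12_fixes_few[OF fin few sub inv xc(1)] xc by simp
    show "x [^] (12::nat) \<noteq> \<one>"
    proof
      assume "x [^] (12::nat) = \<one>"
      then have "n dvd 4 * 3" using pow_eq_id xc by simp
      moreover have "coprime n 4"
        using n coprime_power_right_iff[of n 2 2] coprime_right_2_iff_odd[of n] by simp
      ultimately have "n dvd 3" using coprime_dvd_mult_right_iff[of n 4 3] by simp
      then show False using n by (auto dest: dvd_imp_le)
    qed
  qed
  then have "conjugate g ` gens x = gens x" if "g \<in> carrier G" for g using that x by blast
  then have "conjugate g x \<in> gens x" if "g \<in> carrier G" for g using that gens_refl[OF xc(1)] by blast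
  then have "cyc (conjugate g x) = cyc x" if "g \<in> carrier G" for g using that by (simp add: gens_def)
  then have conjx: "conjugate g x \<in> cyc x" if "g \<in> carrier G" for g
    using that self_in_cyc[of "conjugate g x"] by blast
  have "cyc x \<lhd> G" unfolding normal_inv_iff
  proof (intro conjI ballI)
    show "subgroup (cyc x) G" by (rule subgroup_cyc[OF xc(1)])
    fix g h assume g: "g \<in> carrier G" and "h \<in> cyc x"
    then obtain k :: nat where "h = x [^] k" using in_cyc_iff_pow[OF xc(1)] by auto
    then have "conjugate g h = conjugate g x [^] k" using conjugate_pow[OF g xc(1)] by simp
    moreover obtain l :: nat where "conjugate g x = x [^] l" using conjx[OF g] in_cyc_iff_pow[OF xc(1)] by auto
    ultimately have "conjugate g h = x [^] (l * k)" using xc by (simp add: nat_pow_pow)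
    then show "g \<otimes> h \<otimes> inv g \<in> cyc x" using in_cyc_iff_pow[OF xc(1)] by (auto simp: conjugate_def)
  qed
  then show ?thesis by (rule normal_subgroup_eq_carrier[of _ x]) (use xc n in auto)
qed

text \<open>
  In an abelian simple group every nontrivial element generates, so there is a single class of
  generators.
\<close>

lemma cyclic_imp_kappa:
  assumes x: "x \<in> carrier G" "cyc x = carrier G"
  shows "Factorial_Ring.prime (ord x)" "kappa G = ord x ^ (ord x - 2)"
proof -
  have comm: "g \<otimes> h = h \<otimes> g" if gh: "g \<in> carrier G" "h \<in> carrier G" for g h
  proof -
    obtain k l :: nat where "g = x [^] k" "h = x [^] l" using gh x in_cyc_iff_pow[OF x(1)] by metis
    then show ?thesis using x by (simp add: nat_pow_mult add.commute)
  qed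
  have gen: "cyc y = carrier G" if y: "y \<in> carrier G" "y \<noteq> \<one>" for y
  proof (rule normal_subgroup_eq_carrier[OF _ self_in_cyc[of y] y(2)])
    show "cyc y \<lhd> G" unfolding normal_inv_iff
    proof (intro conjI ballI)
      show "subgroup (cyc y) G" by (rule subgroup_cyc[OF y(1)])
      fix g h assume g: "g \<in> carrier G" and h: "h \<in> cyc y"
      then have "h \<in> carrier G" using cyc_subset[OF y(1)] by auto
      then show "g \<otimes> h \<otimes> inv g \<in> cyc y" using comm[of g h] g h by (simp add: m_assoc)
    qed
  qed
  have ords: "ord y = ord x" if "y \<in> carrier G" "y \<noteq> \<one>" for y
    using gen[OF that] x card_cyc[of x] card_cyc[of y] that by simp
  have "x \<noteq> \<one>"
  proof
    assume "x = \<one>"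
    then show False using x(2) cyc_one simple_not_triv by simp
  qed
  show p: "Factorial_Ring.prime (ord x)" unfolding prime_nat_iff
  proof (intro conjI allI impI)
    show "1 < ord x" using ord_pos[OF x(1)] ord_eq_1[OF x(1)] \<open>x \<noteq> \<one>\<close> by linarith
    fix d assume d: "d dvd ord x"
    show "d = 1 \<or> d = ord x"
    proof (cases "x [^] d = \<one>")
      case True
      then show ?thesis using pow_eq_id[OF x(1)] d by (auto intro: dvd_antisym)
    next
      case False
      then have "ord x div d = ord x" using ords[of "x [^] d"] ord_pow[OF x(1) d] d ord_pos[OF x(1)] x by fastforce
      moreover have "d * (ord x div d) = ord x" using d by simp
      ultimately show ?thesis using ord_pos[OF x(1)] by simp
    qed
  qed
  have "gens ` (carrier G - {\<one>}) = (\<lambda>_. gens x) ` (carrier G - {\<one>})"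
  proof (rule image_cong[OF refl])
    fix y assume "y \<in> carrier G - {\<one>}"
    then show "gens y = gens x" using gen[of y] x by (simp add: gens_def)
  qed
  then have "gen_classes = {gens x}"
    using x(1) \<open>x \<noteq> \<one>\<close> image_constant[of x "carrier G - {\<one>}" "gens x"] by (simp add: gen_classes_def)
  then have "kappa G = (card (gens x) + 1) ^ (card (gens x) - 1)"
    using kappa_eq_prod_if_prime_orders ords p by simp
  then show "kappa G = ord x ^ (ord x - 2)"
    using gens_prime_ord(2)[OF x(1) p] prime_ge_2_nat[OF p] by (simp add: numeral_2_eq_2)
qed

lemma orders_if_kappa:
  assumes kappa: "kappa G = 3 ^ 10 * 5 ^ 18" and x: "x \<in> carrier G"
  shows "ord x \<in> {1, 2, 3, 5}"
proof (cases "even (ord x)")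
  case True
  have "odd (kappa G)" unfolding kappa by simp
  then show ?thesis using even_kappa_if_even_ord[OF x True] by auto
next
  case False
  let ?n = "ord x"
  have "\<not> ?n \<ge> 7"
  proof
    assume n: "?n \<ge> 7"
    have "7 ^ (5 * card (gens ` elems_of_ord ?n)) \<le> (3 ^ 10 * 5 ^ 18 :: nat)"
      using kappa_ge_of_large_classes[OF False n] kappa by simp
    also have "\<dots> < 7 ^ 25" by simp
    finally have "5 * card (gens ` elems_of_ord ?n) < 25"
      by (rule power_less_imp_less_exp[rotated]) simp
    then have "card (gens ` elems_of_ord ?n) \<le> 4" by linarith
    then have "cyc x = carrier G"
      using cyc_eq_carrier_if_few_classes[OF False n] x by (simp add: elems_of_ord_def)
    then have p: "Factorial_Ring.prime ?n" and "?n ^ (?n - 2) = 3 ^ 10 * 5 ^ 18"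
      using cyclic_imp_kappa[OF x] kappa by auto
    then have "3 dvd ?n ^ (?n - 2)" by simp
    then have "3 dvd ?n" using prime_dvd_power[of "3::nat"] by simp
    then show False using p n by (auto simp: prime_nat_iff)
  qed
  moreover have "?n \<noteq> 0" using ord_pos[OF x] by simp
  ultimately have "?n \<in> {1, 2, 3, 4, 5, 6}" by auto
  then show ?thesis using False by auto
qed

lemma elems_of_ord_if_kappa:
  assumes kappa: "kappa G = 3 ^ 10 * 5 ^ 18"
  shows "card (elems_of_ord 3) = 20" "card (elems_of_ord 5) = 24"
proof -
  obtain c3 c5 where c: "kappa G = 3 ^ c3 * 5 ^ (3 * c5)"
    "card (elems_of_ord 3) = 2 * c3" "card (elems_of_ord 5) = 4 * c5"
    by (rule kappa_if_orders_2_3_5[OF orders_if_kappa[OF kappa]])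
  have "c3 = 10 \<and> 3 * c5 = 18" by (rule prime_power_products_eq) (use c(1) kappa in simp)
  then show "card (elems_of_ord 3) = 20" "card (elems_of_ord 5) = 24" using c by auto
qed

end

section \<open>Groups whose elements have order 1, 2, 3 or 5\<close>

context group
begin

lemma conjugate_closed_subgroup_normal:
  assumes "subgroup H G" "\<And>g h. g \<in> carrier G \<Longrightarrow> h \<in> H \<Longrightarrow> conjugate g h \<in> H"
  shows "H \<lhd> G"
  using assms by (simp add: normal_inv_iff conjugate_def)

lemma ord_dvd_if_pow_Suc_eq:
  assumes "g \<in> carrier G" "g [^] Suc m = g" shows "ord g dvd m"
proof -
  have "g [^] m \<otimes> g = \<one> \<otimes> g" using assms by simp
  then have "g [^] m = \<one>" using assms(1) by (metis nat_pow_closed one_closed right_cancel)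
  then show ?thesis using pow_eq_id assms(1) by simp
qed

end

locale orders_2_3_5 = finite_group +
  assumes ords: "x \<in> carrier G \<Longrightarrow> ord x \<in> {1, 2, 3, 5}"
begin

lemma prime_ord: "x \<in> carrier G \<Longrightarrow> x \<noteq> \<one> \<Longrightarrow> Factorial_Ring.prime (ord x)"
  using ords[of x] ord_eq_1[of x] by auto

lemma finite_elems [simp]: "finite (elems_of_ord n)"
  by (simp add: elems_of_ord_def)

lemma elems_cases:
  "x \<in> carrier G \<Longrightarrow> x = \<one> \<or> x \<in> elems_of_ord 2 \<or> x \<in> elems_of_ord 3 \<or> x \<in> elems_of_ord 5"
  using ords[of x] ord_eq_1[of x] by (auto simp: elems_of_ord_def)

lemma ccl_subset_elems: "g \<in> elems_of_ord n \<Longrightarrow> ccl g \<subseteq> elems_of_ord n"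
  by (auto simp: ccl_def elems_of_ord_def)

text \<open>The product of commuting elements of distinct prime orders \<open>p\<close> and \<open>q\<close> would have order
  \<open>p * q\<close>.\<close>

lemma ord_in_centr:
  assumes g: "g \<in> carrier G" "g \<noteq> \<one>" and h: "h \<in> centr g" "h \<noteq> \<one>"
  shows "ord h = ord g"
proof (rule ccontr)
  assume ne: "ord h \<noteq> ord g"
  have hc: "h \<in> carrier G" and comm: "g \<otimes> h = h \<otimes> g" using h by (auto simp: centr_def)
  let ?s = "ord (g \<otimes> h)"
  have pg: "Factorial_Ring.prime (ord g)" and ph: "Factorial_Ring.prime (ord h)" using prime_ord g h hc by auto
  have pow: "(g \<otimes> h) [^] (n::nat) = g [^] n \<otimes> h [^] n" for n
    using pow_mult_distrib[OF comm g(1) hc] .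
  have "\<not> ?s dvd ord g"
  proof
    assume "?s dvd ord g"
    then have "h [^] ord g = \<one>" using pow[of "ord g"] pow_eq_id[of "g \<otimes> h" "ord g"] g hc by simp
    then show False using pow_eq_id[OF hc] primes_dvd_imp_eq[OF ph pg] ne by simp
  qed
  moreover have "\<not> ?s dvd ord h"
  proof
    assume "?s dvd ord h"
    then have "g [^] ord h = \<one>" using pow[of "ord h"] pow_eq_id[of "g \<otimes> h" "ord h"] g hc by simp
    then show False using pow_eq_id[OF g(1)] primes_dvd_imp_eq[OF pg ph] ne by simp
  qed
  ultimately have "?s \<noteq> 1" by (metis one_dvd)
  then have "g \<otimes> h \<noteq> \<one>" by (metis ord_id)
  then have "Factorial_Ring.prime ?s" using prime_ord g hc by simp
  moreover have "?s dvd ord g * ord h" by (rule ord_mul_divides[OF comm g(1) hc])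
  ultimately have "?s dvd ord g \<or> ?s dvd ord h" by (rule prime_dvd_multD)
  then show False using \<open>\<not> ?s dvd ord g\<close> \<open>\<not> ?s dvd ord h\<close> by blast
qed

lemma centr_subset: "g \<in> carrier G \<Longrightarrow> g \<noteq> \<one> \<Longrightarrow> centr g \<subseteq> insert \<one> (elems_of_ord (ord g))"
  using ord_in_centr[of g] unfolding elems_of_ord_def centr_def by blast

lemma card_centr:
  assumes g: "g \<in> carrier G" "g \<noteq> \<one>"
  shows "ord g dvd card (centr g)" "card (centr g) dvd order G" "0 < card (centr g)"
    "Factorial_Ring.prime q \<Longrightarrow> q \<noteq> ord g \<Longrightarrow> \<not> q dvd card (centr g)"
proof -
  have sg: "subgroup (centr g) G" by (rule subgroup_centr[OF g(1)])
  have "cyc g \<subseteq> centr g" using generate_subgroup_incl[of "{g}", OF _ sg] g by (auto simp: centr_def)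
  then show "ord g dvd card (centr g)"
    using card_subgroup_dvd[OF subgroup_cyc[OF g(1)] sg] card_cyc[OF g(1)] by simp
  show "card (centr g) dvd order G"
    using card_ccl_mult_centr[OF g(1) finite_carrier] by (metis dvd_triv_right)
  have fin: "finite (centr g)" using sg subgroup.subset finite_subset finite_carrier by blast
  then show "0 < card (centr g)" using subgroup.one_closed[OF sg] card_gt_0_iff by blast
  show "\<not> q dvd card (centr g)" if q: "Factorial_Ring.prime q" "q \<noteq> ord g"
  proof
    assume "q dvd card (centr g)"
    then obtain x where x: "x \<in> centr g" "ord x = q" using cauchy[OF finite_carrier sg q(1)] by blast
    then have "x \<noteq> \<one>" using q(1) by auto
    then show False using ord_in_centr[OF g x(1)] x q by simp
  qed
qed

lemma card_centr_dvd:
  assumes g: "g \<in> carrier G" "g \<noteq> \<one>" and mk: "order G = m * k" "\<not> ord g dvd m"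
  shows "card (centr g) dvd k"
proof -
  have "coprime (card (centr g)) m"
  proof (rule ccontr)
    assume "\<not> coprime (card (centr g)) m"
    then obtain q where q: "Factorial_Ring.prime q" "q dvd card (centr g)" "q dvd m"
      using prime_factor_nat[of "gcd (card (centr g)) m"] by (auto simp: coprime_iff_gcd_eq_1)
    then have "q \<noteq> ord g" using mk(2) by auto
    then show False using card_centr(4)[OF g q(1)] q(2) by simp
  qed
  then show ?thesis using card_centr(2)[OF g] mk(1) by (simp add: coprime_dvd_mult_right_iff)
qed

text \<open>If \<open>x\<close> conjugates \<open>g\<close> to its square, then \<open>x\<^sup>n\<close> conjugates it to \<open>g ^ (2 ^ n)\<close>; taking for \<open>n\<close>
  the order of \<open>x\<close>, this would force 5 to divide one of 1, 3, 7 and 31.\<close>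

lemma not_conj_square:
  assumes g: "g \<in> elems_of_ord 5" and x: "x \<in> carrier G"
  shows "conjugate x g \<noteq> g [^] (2::nat)"
proof
  assume sq: "conjugate x g = g [^] (2::nat)"
  have gc: "g \<in> carrier G" "ord g = 5" using g by (auto simp: elems_of_ord_def)
  have pow: "conjugate (x [^] n) g = g [^] ((2::nat) ^ n)" for n :: nat
  proof (induction n)
    case (Suc n)
    have "conjugate (x [^] Suc n) g = conjugate (x [^] n) (g [^] (2::nat))"
      using x gc by (simp add: conjugate_mult_left sq)
    then show ?case using conjugate_pow[of "x [^] n" g 2] Suc x gc by (simp add: nat_pow_pow mult.commute)
  qed (use gc in simp)
  have "g [^] Suc (2 ^ ord x - 1) = g" using pow[of "ord x"] x gc by simp
  from ord_dvd_if_pow_Suc_eq[OF gc(1) this] have "5 dvd (2::nat) ^ ord x - 1" using gc(2) by simp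
  then show False using ords[OF x] by auto
qed

text \<open>
  The squares of the conjugates of \<open>g\<close> have order 5 as well and, by the previous lemma, are not
  conjugate to \<open>g\<close>. Squaring is injective here because cubing inverts it.
\<close>

lemma card_ccl_ord_5:
  assumes g: "g \<in> elems_of_ord 5" shows "2 * card (ccl g) \<le> card (elems_of_ord 5)"
proof -
  let ?sq = "\<lambda>y. y [^] (2::nat)"
  have sub: "ccl g \<subseteq> elems_of_ord 5" by (rule ccl_subset_elems[OF g])
  have six: "(y [^] (2::nat)) [^] (3::nat) = y" if "y \<in> elems_of_ord 5" for y
  proof -
    have "(y [^] (2::nat)) [^] (3::nat) = y [^] Suc 5" using that by (simp add: nat_pow_pow elems_of_ord_def del: nat_pow_Suc)
    also have "\<dots> = y [^] (5::nat) \<otimes> y" by (rule nat_pow_Suc)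
    also have "\<dots> = y" using that pow_ord_eq_1[of y] by (auto simp: elems_of_ord_def)
    finally show ?thesis .
  qed
  have "inj_on ?sq (elems_of_ord 5)" by (rule inj_on_inverseI[where g = "\<lambda>y. y [^] (3::nat)"]) (rule six)
  then have "card (?sq ` ccl g) = card (ccl g)" using sub by (meson card_image inj_on_subset)
  moreover have "?sq ` ccl g \<subseteq> elems_of_ord 5"
  proof
    fix z assume "z \<in> ?sq ` ccl g"
    then obtain y where y: "y \<in> carrier G" "ord y = 5" "z = ?sq y" using sub by (auto simp: elems_of_ord_def)
    then show "z \<in> elems_of_ord 5" using pow_ord_eq_ord_iff[of y 2] by (simp add: elems_of_ord_def)
  qed
  moreover have "ccl g \<inter> ?sq ` ccl g = {}"
  proof (rule ccontr)
    assume "ccl g \<inter> ?sq ` ccl g \<noteq> {}"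
    then obtain z where z: "z \<in> ccl g" "?sq z \<in> ccl g" by auto
    then have "?sq z \<in> ccl z" using ccl_eq[of g z] g by (simp add: elems_of_ord_def)
    then obtain h where h: "h \<in> carrier G" "?sq z = conjugate h z" by (auto simp: ccl_def)
    have "z \<in> elems_of_ord 5" using sub z by blast
    from not_conj_square[OF this h(1)] show False using h(2) by simp
  qed
  ultimately show ?thesis
    using card_mono[of "elems_of_ord 5" "ccl g \<union> ?sq ` ccl g"] sub card_Un_disjoint[of "ccl g" "?sq ` ccl g"]
    by (simp add: ccl_def)
qed

end

text \<open>
  The order of the centralizer of an element of order 5 is a multiple of 5 prime to 6, and at most 25.
  If it were 25, the centralizer would comprise all elements of order 5 and be normal. So it is 5, and all classes of elements of order 5 have the same size \<open>c = |G| / 5\<close>.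
\<close>

lemma (in finite_simple_group) order_if_kappa:
  assumes kappa: "kappa G = 3 ^ 10 * 5 ^ 18"
  shows "order G = 60"
proof -
  interpret orders_2_3_5 G by unfold_locales (rule orders_if_kappa[OF kappa])
  note cards = elems_of_ord_if_kappa[OF kappa]
  have centr5: "card (centr g) = 5" if g: "g \<in> elems_of_ord 5" for g
  proof -
    have gc: "g \<in> carrier G" "ord g = 5" "g \<noteq> \<one>" using g by (auto simp: elems_of_ord_def)
    have sub: "centr g \<subseteq> insert \<one> (elems_of_ord 5)" using centr_subset[OF gc(1,3)] gc(2) by simp
    have one: "\<one> \<notin> elems_of_ord 5" by (simp add: elems_of_ord_def)
    then have c25: "card (insert \<one> (elems_of_ord 5)) = 25" using cards by simp
    have "card (centr g) \<noteq> 25"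
    proof
      assume "card (centr g) = 25"
      then have eq: "centr g = insert \<one> (elems_of_ord 5)" using card_subset_eq[OF _ sub] c25 by simp
      have "centr g \<lhd> G"
        by (rule conjugate_closed_subgroup_normal[OF subgroup_centr[OF gc(1)]]) (auto simp: eq elems_of_ord_def)
      then have "centr g = carrier G"
        by (rule normal_subgroup_eq_carrier[of _ g]) (use gc in \<open>auto simp: centr_def\<close>)
      then have "elems_of_ord 3 \<subseteq> insert \<one> (elems_of_ord 5)" using eq by (auto simp: elems_of_ord_def)
      moreover have "x \<notin> insert \<one> (elems_of_ord 5)" if "x \<in> elems_of_ord 3" for x
        using that by (auto simp: elems_of_ord_def)
      ultimately have "elems_of_ord 3 = {}" by blast
      then show False using cards by simp
    qed
    moreover have "card (centr g) \<le> 25" using card_mono[OF _ sub] c25 by simp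
    moreover obtain k where k: "card (centr g) = 5 * k" using card_centr(1)[OF gc(1,3)] gc(2) by auto
    moreover have "\<not> 2 dvd card (centr g)" "\<not> 3 dvd card (centr g)"
      using card_centr(4)[OF gc(1,3), of 2] card_centr(4)[OF gc(1,3), of 3] gc(2) by auto
    ultimately have "k \<le> 5" "k \<noteq> 5" "k \<noteq> 0" "k \<noteq> 2" "k \<noteq> 3" "k \<noteq> 4"
      using card_centr(3)[OF gc(1,3)] by auto
    then show ?thesis using k by auto
  qed
  have cl: "card (ccl g) * 5 = order G" if "g \<in> elems_of_ord 5" for g
    using card_ccl_mult_centr[of g] centr5[OF that] that by (simp add: elems_of_ord_def)
  obtain g where g: "g \<in> elems_of_ord 5" using cards by fastforce
  define c where "c = card (ccl g)"
  have c: "c * 5 = order G" "2 * c \<le> 24" using cl[OF g] card_ccl_ord_5[OF g] cards by (auto simp: c_def)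
  have "\<Union>(ccl ` elems_of_ord 5) = elems_of_ord 5"
    using ccl_subset_elems ccl_refl by (fastforce simp: elems_of_ord_def)
  moreover have "c dvd card (\<Union>(ccl ` elems_of_ord 5))"
  proof (rule dvd_partition)
    show "finite (\<Union>(ccl ` elems_of_ord 5))" using calculation by simp
    have "card (ccl h) = c" if "h \<in> elems_of_ord 5" for h using cl[OF that] c(1) by linarith
    then show "\<forall>A\<in>ccl ` elems_of_ord 5. c dvd card A" by auto
    show "\<forall>A\<in>ccl ` elems_of_ord 5. \<forall>B\<in>ccl ` elems_of_ord 5. A \<noteq> B \<longrightarrow> A \<inter> B = {}"
    proof (intro ballI impI, rule ccontr)
      fix A B assume "A \<in> ccl ` elems_of_ord 5" "B \<in> ccl ` elems_of_ord 5" and ne: "A \<noteq> B" "A \<inter> B \<noteq> {}"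
      then obtain a b where "a \<in> carrier G" "b \<in> carrier G" "A = ccl a" "B = ccl b" by (auto simp: elems_of_ord_def)
      then show False using ccl_disjoint[of a b] ccl_eq[of a b] ne by simp
    qed
  qed
  ultimately have "c dvd 24" using cards by simp
  \<comment> \<open>Since \<open>5 * c \<ge> 20 + 24\<close>, the only divisor of 24 left for \<open>c \<le> 12\<close> is 12.\<close>
  have "card (elems_of_ord 3 \<union> elems_of_ord 5) = 44"
    using cards by (subst card_Un_disjoint) (auto simp: elems_of_ord_def)
  then have "44 \<le> order G"
    using card_mono[OF finite_carrier, of "elems_of_ord 3 \<union> elems_of_ord 5"] by (auto simp: elems_of_ord_def order_def)
  then have "c = 9 \<or> c = 10 \<or> c = 11 \<or> c = 12" using c by linarith
  then have "c = 12" using \<open>c dvd 24\<close> by auto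
  then show ?thesis using c by simp
qed

section \<open>Groups of order 60\<close>

locale A5_like = orders_2_3_5 +
  assumes order_60: "order G = 60"
    and card_3: "card (elems_of_ord 3) = 20" and card_5: "card (elems_of_ord 5) = 24"
begin

lemma card_2: "card (elems_of_ord 2) = 15"
proof -
  have "carrier G = {\<one>} \<union> (elems_of_ord 2 \<union> (elems_of_ord 3 \<union> elems_of_ord 5))"
    using elems_cases by (auto simp: elems_of_ord_def)
  moreover have "card ({\<one>} \<union> (elems_of_ord 2 \<union> (elems_of_ord 3 \<union> elems_of_ord 5))) =
      1 + (card (elems_of_ord 2) + (card (elems_of_ord 3) + card (elems_of_ord 5)))"
    by (subst card_Un_disjoint; (subst card_Un_disjoint)?; (subst card_Un_disjoint)?)
      (auto simp: elems_of_ord_def)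
  ultimately show ?thesis using order_60 card_3 card_5 by (simp add: order_def)
qed

lemma card_ccl_centr:
  assumes "g \<in> carrier G" shows "card (ccl g) * card (centr g) = 60"
  using card_ccl_mult_centr[OF assms finite_carrier] order_60 by simp

lemma card_centr_2:
  assumes t: "t \<in> elems_of_ord 2" shows "card (centr t) = 4"
proof -
  have tc: "t \<in> carrier G" "ord t = 2" "t \<noteq> \<one>" using t by (auto simp: elems_of_ord_def)
  have "card (centr t) dvd 4"
    using card_centr_dvd[OF tc(1,3), of 15 4] order_60 tc(2) by simp
  then have "card (centr t) \<le> 4" by (simp add: dvd_imp_le)
  \<comment> \<open>A centralizer of order 2 would give 30 conjugates, but there are only 15 involutions.\<close>
  moreover have "card (ccl t) \<le> 15" using card_mono[OF _ ccl_subset_elems[OF t]] card_2 by simp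
  then have "card (centr t) \<le> 3 \<Longrightarrow> card (ccl t) * card (centr t) \<le> 15 * 3" by (intro mult_le_mono)
  ultimately show ?thesis using card_ccl_centr[OF tc(1)] by linarith
qed

lemma card_centr_odd:
  assumes p: "p = 3 \<or> p = 5" and g: "g \<in> elems_of_ord p"
  shows "card (centr g) = p"
proof -
  have gc: "g \<in> carrier G" "ord g = p" "g \<noteq> \<one>" using g p by (auto simp: elems_of_ord_def)
  have "card (centr g) dvd p"
    using p card_centr_dvd[OF gc(1,3), of "60 div p" p] order_60 gc(2) by auto
  then show ?thesis using card_centr(1)[OF gc(1,3)] gc(2) by (simp add: dvd_antisym)
qed

text \<open>
  The elements of order 2 and those of order 3 form a single class. Those of order 5 form two classes of
  size 12, and squaring exchanges the two.
\<close>

lemma normal_contains_elems: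
  assumes N: "N \<lhd> G" and p: "p \<in> {2, 3, 5}" and x: "x \<in> N" "x \<in> elems_of_ord p"
  shows "elems_of_ord p \<subseteq> N"
proof -
  have xc: "x \<in> carrier G" using x by (simp add: elems_of_ord_def)
  have sgN: "subgroup N G" using N by (rule normal_imp_subgroup)
  have cclN: "ccl y \<subseteq> N" if "y \<in> N" for y
    using normal_invE(2)[OF N _ that] by (auto simp: ccl_def conjugate_def)
  consider "p = 2" | "p = 3" | "p = 5" using p by auto
  then have "\<exists>A. A \<subseteq> N \<and> A \<subseteq> elems_of_ord p \<and> card A = card (elems_of_ord p)"
  proof cases
    case 1
    then have "card (ccl x) = 15" using card_ccl_centr[OF xc] card_centr_2 x by simp
    then show ?thesis using cclN[OF x(1)] ccl_subset_elems[OF x(2)] card_2 1 by auto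
  next
    case 2
    then have "card (ccl x) = 20" using card_ccl_centr[OF xc] card_centr_odd[of 3] x by simp
    then show ?thesis using cclN[OF x(1)] ccl_subset_elems[OF x(2)] card_3 2 by auto
  next
    case 3
    let ?y = "x [^] (2::nat)"
    have y: "?y \<in> elems_of_ord 5"
      using pow_ord_eq_ord_iff[of x 2] x 3 by (auto simp: elems_of_ord_def)
    have yN: "?y \<in> N" using x(1) xc subgroup.m_closed[OF sgN] by (simp add: numeral_2_eq_2)
    have yc: "?y \<in> carrier G" using xc by simp
    have cards: "card (ccl x) = 12" "card (ccl ?y) = 12"
      using card_ccl_centr[OF xc] card_ccl_centr[OF yc] card_centr_odd[OF _ y] card_centr_odd[of 5 x] x 3 by auto
    have "ccl x \<inter> ccl ?y = {}"
    proof (rule ccontr)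
      assume "ccl x \<inter> ccl ?y \<noteq> {}"
      then have "?y \<in> ccl x" by (rule ccl_disjoint[OF xc yc])
      then obtain h where h: "h \<in> carrier G" "?y = conjugate h x" by (auto simp: ccl_def)
      have "x \<in> elems_of_ord 5" using x 3 by simp
      from not_conj_square[OF this h(1)] show False using h(2) by simp
    qed
    then have "card (ccl x \<union> ccl ?y) = 24"
      using cards by (subst card_Un_disjoint) (auto simp: ccl_def)
    then show ?thesis
      using cclN[OF x(1)] cclN[OF yN] ccl_subset_elems[OF x(2)] ccl_subset_elems[OF y] card_5 3
      by (intro exI[of _ "ccl x \<union> ccl ?y"]) auto
  qed
  then show ?thesis using card_subset_eq[of "elems_of_ord p"] by auto
qed

text \<open>
  A normal subgroup has \<open>1 + 15 * i + 20 * j + 24 * k\<close> elements with \<open>i\<close>, \<open>j\<close>, \<open>k\<close> among 0 and 1, and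
  this number divides 60 only if it is 1 or 60.
\<close>

theorem simple: "simple_group G"
proof
  show "1 < order G" using order_60 by simp
next
  fix N assume N: "N \<lhd> G"
  have sgN: "subgroup N G" using N by (rule normal_imp_subgroup)
  have NG: "N \<subseteq> carrier G" using sgN by (rule subgroup.subset)
  let ?N = "\<lambda>p. N \<inter> elems_of_ord p"
  have "N = {\<one>} \<union> (?N 2 \<union> (?N 3 \<union> ?N 5))"
    using elems_cases NG subgroup.one_closed[OF sgN] by auto
  moreover have "card ({\<one>} \<union> (?N 2 \<union> (?N 3 \<union> ?N 5))) = 1 + (card (?N 2) + (card (?N 3) + card (?N 5)))"
    by (subst card_Un_disjoint; (subst card_Un_disjoint)?; (subst card_Un_disjoint)?)
      (auto simp: elems_of_ord_def)
  ultimately have cardN: "card N = 1 + (card (?N 2) + (card (?N 3) + card (?N 5)))" by simp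
  have cases: "?N p = {} \<or> ?N p = elems_of_ord p" if "p \<in> {2, 3, 5}" for p
    using normal_contains_elems[OF N that] by blast
  have "card (?N 2) \<in> {0, 15}" "card (?N 3) \<in> {0, 20}" "card (?N 5) \<in> {0, 24}"
    using cases[of 2] cases[of 3] cases[of 5] card_2 card_3 card_5 by auto
  moreover have "card N dvd 60"
    using card_subgroup_dvd[OF sgN subgroup_self NG] order_60 by (simp add: order_def)
  moreover have "n = 1 \<or> n = 60"
    if "i \<in> {0, 15}" "j \<in> {0, 20}" "k \<in> {0, 24}" "n dvd 60" "n = 1 + (i + (j + k))" for i j k n :: nat
    using that by auto
  ultimately have "card N = 1 \<or> card N = 60" using cardN by blast
  then show "N = carrier G \<or> N = {\<one>}"
  proof
    assume "card N = 1"
    then show ?thesis using subgroup.one_closed[OF sgN] by (auto simp: card_1_singleton_iff)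
  next
    assume "card N = 60"
    then show ?thesis using card_subset_eq[OF finite_carrier NG] order_60 by (simp add: order_def)
  qed
qed

lemma centr_2_comm:
  assumes t: "t \<in> elems_of_ord 2" and a: "a \<in> centr t" and b: "b \<in> centr t"
  shows "a \<otimes> b = b \<otimes> a"
proof -
  have tc: "t \<in> carrier G" "ord t = 2" "t \<noteq> \<one>" using t by (auto simp: elems_of_ord_def)
  have self_inv: "inv y = y" if "y \<in> centr t" for y
    using centr_subset[OF tc(1,3)] that tc(2) inv_eq_self_iff[of y] by (auto simp: elems_of_ord_def)
  have ab: "a \<in> carrier G" "b \<in> carrier G" using a b by (auto simp: centr_def)
  have "a \<otimes> b \<in> centr t" using subgroup.m_closed[OF subgroup_centr[OF tc(1)] a b] .
  then have "a \<otimes> b = inv (a \<otimes> b)" using self_inv by simp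
  also have "\<dots> = b \<otimes> a" using ab self_inv a b by (simp add: inv_mult_group)
  finally show ?thesis .
qed

lemma centr_2_eq:
  assumes t: "t \<in> elems_of_ord 2" and s: "s \<in> elems_of_ord 2" "s \<in> centr t"
  shows "centr s = centr t"
proof -
  have "centr t \<subseteq> centr s" using centr_2_comm[OF t _ s(2)] by (auto simp: centr_def)
  then show ?thesis
    using card_subset_eq[of "centr s" "centr t"] card_centr_2[OF t] card_centr_2[OF s(1)] by (simp add: centr_def)
qed

lemma conjugate_centr:
  assumes g: "g \<in> carrier G" and t: "t \<in> elems_of_ord 2"
  shows "conjugate g ` centr t = centr (conjugate g t)"
proof (rule card_subset_eq)
  have tc: "t \<in> carrier G" and gt: "conjugate g t \<in> elems_of_ord 2" using t g by (auto simp: elems_of_ord_def)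
  show "finite (centr (conjugate g t))" by (simp add: centr_def)
  show "conjugate g ` centr t \<subseteq> centr (conjugate g t)"
  proof
    fix y assume "y \<in> conjugate g ` centr t"
    then obtain h where h: "h \<in> carrier G" "h \<otimes> t = t \<otimes> h" "y = conjugate g h" by (auto simp: centr_def)
    then show "y \<in> centr (conjugate g t)" using g tc by (simp add: centr_def conjugate_mult[symmetric])
  qed
  have "inj_on (conjugate g) (centr t)" using conjugate_inj[OF g] by (auto simp: inj_on_def centr_def)
  then show "card (conjugate g ` centr t) = card (centr (conjugate g t))"
    using card_centr_2[OF t] card_centr_2[OF gt] by (simp add: card_image)
qed

text \<open>
  Centralizers of involutions are elementary abelian of order 4, and two of them meet trivially or
  coincide; so the 15 involutions are partitioned into sets of 3.
\<close>

lemma card_fours: "card (centr ` elems_of_ord 2) = 5"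
proof -
  let ?V = "\<lambda>t. centr t - {\<one>}"
  let ?E = "?V ` elems_of_ord 2"
  have V: "?V t \<subseteq> elems_of_ord 2" "t \<in> ?V t" "card (?V t) = 3" if t: "t \<in> elems_of_ord 2" for t
  proof -
    have tc: "t \<in> carrier G" "ord t = 2" "t \<noteq> \<one>" using t by (auto simp: elems_of_ord_def)
    show "?V t \<subseteq> elems_of_ord 2" using centr_subset[OF tc(1,3)] tc by auto
    show "t \<in> ?V t" using tc by (simp add: centr_def)
    show "card (?V t) = 3" using card_centr_2[OF t] subgroup.one_closed[OF subgroup_centr[OF tc(1)]] by simp
  qed
  have "\<Union>?E = elems_of_ord 2" using V by blast
  moreover have "3 * card ?E = card (\<Union>?E)"
  proof (rule card_partition)
    show "finite (\<Union>?E)" using calculation by simp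
    show "A \<inter> B = {}" if AB: "A \<in> ?E" "B \<in> ?E" "A \<noteq> B" for A B
    proof (rule ccontr)
      assume "A \<inter> B \<noteq> {}"
      then obtain s where s: "s \<in> A" "s \<in> B" by blast
      obtain a where a: "a \<in> elems_of_ord 2" "A = ?V a" using AB(1) by blast
      obtain b where b: "b \<in> elems_of_ord 2" "B = ?V b" using AB(2) by blast
      have "s \<in> elems_of_ord 2" using V(1)[OF a(1)] s a by blast
      then have "centr s = centr a" "centr s = centr b"
        using centr_2_eq[OF a(1)] centr_2_eq[OF b(1)] s a(2) b(2) by auto
      then show False using a(2) b(2) AB(3) by simp
    qed
  qed (use V(3) in auto)
  ultimately have "card ?E = 5" using card_2 by simp
  moreover have "?E = (\<lambda>C. C - {\<one>}) ` centr ` elems_of_ord 2" by (simp add: image_image)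
  moreover have "inj_on (\<lambda>C. C - {\<one>}) (centr ` elems_of_ord 2)"
  proof (rule inj_onI)
    fix A B assume AB: "A \<in> centr ` elems_of_ord 2" "B \<in> centr ` elems_of_ord 2" "A - {\<one>} = B - {\<one>}"
    have "\<one> \<in> A" "\<one> \<in> B" using AB(1,2) by (auto simp: centr_def elems_of_ord_def)
    then show "A = B" using AB(3) by blast
  qed
  ultimately show ?thesis by (simp add: card_image)
qed

theorem iso_alt_group_5: "G \<cong> alt_group 5"
proof -
  interpret simple_group G by (rule simple)
  let ?E = "centr ` elems_of_ord 2"
  have inv: "conjugate g ` A \<in> ?E" if "g \<in> carrier G" "A \<in> ?E" for g A
    using that conjugate_centr by (auto simp: elems_of_ord_def)
  have comp: "conjugate (g \<otimes> h) ` A = conjugate g ` conjugate h ` A" if "g \<in> carrier G" "h \<in> carrier G" "A \<in> ?E" for g h A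
    by (rule conjugate_image_mult) (use that in \<open>auto simp: centr_def\<close>)
  obtain e where "bij_betw e {1..card ?E} ?E" using ex_bij_betw_nat_finite_1[of ?E] by auto
  then have e: "bij_betw e {1..5} ?E" using card_fours by simp
  define e' where "e' = inv_into {1..5::nat} e"
  have eE: "e i \<in> ?E" if "i \<in> {1..5}" for i using bij_betw_apply[OF e that] .
  have e'1: "e' (e i) = i" if "i \<in> {1..5}" for i
    unfolding e'_def by (rule bij_betw_inv_into_left[OF e that])
  have e'2: "e' A \<in> {1..5}" "e (e' A) = A" if "A \<in> ?E" for A
    unfolding e'_def using bij_betw_apply[OF bij_betw_inv_into[OF e] that] bij_betw_inv_into_right[OF e that]
    by blast+
  define \<psi> where "\<psi> g = (\<lambda>i. if i \<in> {1..5} then e' (conjugate g ` e i) else i)" for g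
  have \<psi>_in: "\<psi> g i = e' (conjugate g ` e i)" if "i \<in> {1..5}" for g i
    using that unfolding \<psi>_def by (rule if_P)
  have \<psi>_out: "\<psi> g i = i" if "i \<notin> {1..5}" for g i
    using that unfolding \<psi>_def by (rule if_not_P)
  have perm: "\<psi> g permutes {1..5}" if g: "g \<in> carrier G" for g
  proof (rule bij_imp_permutes)
    have "\<psi> g ` {1..5} \<subseteq> {1..5}"
    proof (rule image_subsetI)
      fix i :: nat assume i: "i \<in> {1..5}"
      show "\<psi> g i \<in> {1..5}" unfolding \<psi>_in[OF i] by (rule e'2(1)[OF inv[OF g eE[OF i]]])
    qed
    moreover have "inj_on (\<psi> g) {1..5}"
    proof (rule inj_onI)
      fix i j assume ij: "i \<in> {1..5}" "j \<in> {1..5}" "\<psi> g i = \<psi> g j"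
      have "e (\<psi> g i) = e (\<psi> g j)" using ij(3) by (rule arg_cong)
      then have "conjugate g ` e i = conjugate g ` e j"
        unfolding \<psi>_in[OF ij(1)] \<psi>_in[OF ij(2)]
          e'2(2)[OF inv[OF g eE[OF ij(1)]]] e'2(2)[OF inv[OF g eE[OF ij(2)]]] .
      moreover have "inj_on (conjugate g) (carrier G)" using conjugate_inj[OF g] by (auto simp: inj_on_def)
      moreover have "e i \<subseteq> carrier G" "e j \<subseteq> carrier G" using eE[OF ij(1)] eE[OF ij(2)] by (auto simp: centr_def)
      ultimately have "e i = e j" using inj_on_image_eq_iff by metis
      then have "e' (e i) = e' (e j)" by (rule arg_cong)
      then show "i = j" unfolding e'1[OF ij(1)] e'1[OF ij(2)] .
    qed
    ultimately show "bij_betw (\<psi> g) {1..5} {1..5}"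
      by (simp add: bij_betw_def endo_inj_surj)
  qed (rule \<psi>_out)
  have \<psi>_hom: "\<psi> (g \<otimes> h) = \<psi> g \<circ> \<psi> h" if "g \<in> carrier G" "h \<in> carrier G" for g h
  proof
    fix i
    show "\<psi> (g \<otimes> h) i = (\<psi> g \<circ> \<psi> h) i"
    proof (cases "i \<in> {1..5}")
      case True
      have "conjugate h ` e i \<in> ?E" using inv[OF that(2) eE[OF True]] .
      then have hi: "\<psi> h i \<in> {1..5}" "e (\<psi> h i) = conjugate h ` e i" unfolding \<psi>_in[OF True] by (rule e'2)+
      have "\<psi> g (\<psi> h i) = e' (conjugate g ` conjugate h ` e i)" unfolding \<psi>_in[OF hi(1)] hi(2) ..
      then show ?thesis unfolding o_apply \<psi>_in[OF True, of "g \<otimes> h"] comp[OF that eE[OF True]] by simp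
    qed (simp add: \<psi>_out del: atLeastAtMost_iff)
  qed
  interpret S: group "sym_group 5" by (rule sym_group_is_group)
  interpret \<psi>: group_hom G "sym_group 5" \<psi>
  proof
    show "\<psi> \<in> hom G (sym_group 5)"
    proof (rule homI)
      show "\<psi> g \<in> carrier (sym_group 5)" if "g \<in> carrier G" for g
        unfolding sym_group_carrier by (rule perm[OF that])
    qed (simp add: sym_group_mult \<psi>_hom)
  qed
  interpret sgn: group sign_img by (rule sign_img_is_group)
  interpret sgn: group_hom G sign_img "sign \<circ> \<psi>"
  proof
    show "sign \<circ> \<psi> \<in> hom G sign_img"
      using \<psi>.homh sign_is_hom[of 5] by (auto simp: hom_def Pi_iff)
  qed
  \<comment> \<open>Otherwise the centralizers of involutions would be normal.\<close>
  have "kernel G (sym_group 5) \<psi> \<noteq> carrier G"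
  proof
    assume ker: "kernel G (sym_group 5) \<psi> = carrier G"
    obtain t where t: "t \<in> elems_of_ord 2" using card_2 by fastforce
    have tc: "t \<in> carrier G" "t \<noteq> \<one>" using t by (auto simp: elems_of_ord_def)
    have fixes_all: "conjugate g ` centr t = centr t" if g: "g \<in> carrier G" for g
    proof -
      let ?i = "e' (centr t)"
      have i: "?i \<in> {1..5}" "e ?i = centr t" using e'2[of "centr t"] t by auto
      have "\<psi> g = id" using g ker by (auto simp: kernel_def sym_group_one)
      then have "\<psi> g ?i = ?i" by simp
      then have "e' (conjugate g ` centr t) = ?i" unfolding \<psi>_in[OF i(1)] i(2) .
      then have "e (e' (conjugate g ` centr t)) = e ?i" by (rule arg_cong)
      then show ?thesis using e'2(2)[of "conjugate g ` centr t"] inv[OF g, of "centr t"] i(2) t by simp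
    qed
    have "centr t \<lhd> G"
      by (rule conjugate_closed_subgroup_normal[OF subgroup_centr[OF tc(1)]]) (use fixes_all in blast)
    moreover have "centr t \<noteq> {\<one>}" using tc by (auto simp: centr_def)
    ultimately have "centr t = carrier G" using no_real_normal_subgroup by blast
    then show False using card_centr_2[OF t] order_60 by (simp add: order_def)
  qed
  then have "kernel G (sym_group 5) \<psi> = {\<one>}" using no_real_normal_subgroup[OF \<psi>.normal_kernel] by blast
  then have inj: "inj_on \<psi> (carrier G)" by (simp add: \<psi>.inj_iff_trivial_ker)
  \<comment> \<open>A homomorphism to a group of order 2 cannot be injective, so by simplicity it is trivial.\<close>
  have "kernel G sign_img (sign \<circ> \<psi>) \<noteq> {\<one>}"
  proof
    assume "kernel G sign_img (sign \<circ> \<psi>) = {\<one>}"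
    then have "inj_on (sign \<circ> \<psi>) (carrier G)" by (simp add: sgn.inj_iff_trivial_ker)
    then have "card (carrier G) \<le> card (carrier sign_img)"
      by (rule card_inj_on_le) (use sgn.hom_closed in \<open>auto simp: sign_img_def\<close>)
    then show False using order_60 by (simp add: order_def sign_img_def)
  qed
  then have "kernel G sign_img (sign \<circ> \<psi>) = carrier G" using no_real_normal_subgroup[OF sgn.normal_kernel] by blast
  then have even: "evenperm (\<psi> g)" if "g \<in> carrier G" for g
    using that by (auto simp: kernel_def sign_img_def sign_def split: if_splits)
  have sub: "\<psi> ` carrier G \<subseteq> carrier (alt_group 5)"
  proof (rule image_subsetI)
    fix g assume "g \<in> carrier G"
    then show "\<psi> g \<in> carrier (alt_group 5)" unfolding alt_group_carrier using perm even by blast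
  qed
  have cA: "card (carrier (alt_group 5)) = 60" using alt_group_card_carrier[of 5] by (simp add: fact_numeral)
  then have "finite (carrier (alt_group 5))" by (intro card_ge_0_finite) simp
  then have "\<psi> ` carrier G = carrier (alt_group 5)"
    using card_subset_eq[OF _ sub] cA card_image[OF inj] order_60 by (simp add: order_def)
  then have "\<psi> \<in> iso G (alt_group 5)"
    using inj \<psi>_hom sub by (auto simp: iso_def hom_def bij_betw_def alt_group_mult)
  then show ?thesis by (auto simp: is_iso_def)
qed

end

section \<open>The alternating group of degree 5\<close>

text \<open>
  A permutation of \<open>{1..5}\<close> is tabulated by its list of values, together with a flag telling whether it
  is even. The permutations moving only elements of \<open>a # S\<close> arise uniquely from those moving only
  elements of \<open>S\<close> by composing with a transposition of \<open>a\<close> and \<open>b\<close>, where \<open>b = a\<close> stands for the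
  identity.
\<close>

fun perm_table :: "nat list \<Rightarrow> (nat list \<times> bool) list" where
  "perm_table [] = [([1, 2, 3, 4, 5], True)]"
| "perm_table (a # S) =
    [(map (transpose a b) xs, s = (a = b)). b \<leftarrow> a # S, (xs, s) \<leftarrow> perm_table S]"

text \<open>
  The dummy entry 0 shifts the list so that position \<open>i\<close> holds the value at \<open>i\<close>.
\<close>

definition apply_table :: "nat list \<Rightarrow> nat list \<Rightarrow> nat list" where
  "apply_table xs = map (\<lambda>i. (0 # xs) ! i)"

definition table_power_id :: "nat \<Rightarrow> nat list \<Rightarrow> bool" where
  "table_power_id n xs \<longleftrightarrow> (apply_table xs ^^ n) [1, 2, 3, 4, 5] = [1, 2, 3, 4, 5]"

lemma set_perm_table:
  assumes "distinct S"
  shows "set (perm_table S) = (\<lambda>p. (map p [1, 2, 3, 4, 5], evenperm p)) ` {p. p permutes set S}"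
  using assms
proof (induction S)
  case Nil
  then show ?case by (simp add: evenperm_id)
next
  case (Cons a S)
  let ?r = "\<lambda>p. (map p [1, 2, 3, 4, 5 :: nat], evenperm p)"
  have even: "evenperm (transpose a b \<circ> p) = (evenperm p = (a = b))" if "p permutes set S" for b p
  proof -
    have "permutation p" using that unfolding permutation_permutes by (intro exI[of _ "set S"]) simp
    then have "evenperm (transpose a b \<circ> p) = (evenperm (transpose a b) = evenperm p)"
      by (rule evenperm_comp[OF permutation_swap_id])
    then show ?thesis by (auto simp: evenperm_swap)
  qed
  let ?P = "{p. p permutes set S}"
  have pairs: "(\<Union>b\<in>B. f b ` P) = (\<lambda>(b, p). f b p) ` {(b, p). b \<in> B \<and> p \<in> P}" for B P and f :: "nat \<Rightarrow> (nat \<Rightarrow> nat) \<Rightarrow> nat list \<times> bool"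
    by auto
  have "set (perm_table (a # S)) =
      (\<Union>b\<in>insert a (set S). (\<lambda>(xs, s). (map (transpose a b) xs, s = (a = b))) ` set (perm_table S))"
    by simp
  also have "\<dots> = (\<Union>b\<in>insert a (set S). (\<lambda>p. ?r (transpose a b \<circ> p)) ` ?P)"
  proof (rule SUP_cong[OF refl])
    fix b
    have S: "set (perm_table S) = ?r ` ?P" using Cons by simp
    show "(\<lambda>(xs, s). (map (transpose a b) xs, s = (a = b))) ` set (perm_table S) =
        (\<lambda>p. ?r (transpose a b \<circ> p)) ` ?P"
      unfolding S image_image by (rule image_cong[OF refl]) (use even in simp)
  qed
  also have "\<dots> = ?r ` {p. p permutes set (a # S)}"
    unfolding pairs list.set permutes_insert image_image by (simp add: case_prod_beta)
  finally show ?case .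
qed

text \<open>
  The two counts include the identity.
\<close>

lemma count_pow_3:
  "length (remdups (map fst (filter (\<lambda>(xs, s). s \<and> table_power_id 3 xs) (perm_table [1, 2, 3, 4, 5])))) = 21"
  by code_simp

lemma count_pow_5:
  "length (remdups (map fst (filter (\<lambda>(xs, s). s \<and> table_power_id 5 xs) (perm_table [1, 2, 3, 4, 5])))) = 25"
  by code_simp

lemma orders_in_table:
  "list_all (\<lambda>(xs, s). s \<longrightarrow> table_power_id 2 xs \<or> table_power_id 3 xs \<or> table_power_id 5 xs)
    (perm_table [1, 2, 3, 4, 5])"
  by code_simp

declare perm_table.simps [simp del]

lemma apply_table_map:
  assumes "set ys \<subseteq> {1..5}"
  shows "apply_table (map p [1, 2, 3, 4, 5]) ys = map p ys"
proof -
  have "(0 # map p [1, 2, 3, 4, 5]) ! i = p i" if "i \<in> {1..5}" for i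
  proof -
    have "i = 1 \<or> i = 2 \<or> i = 3 \<or> i = 4 \<or> i = 5" using that by auto
    then show ?thesis by (elim disjE) simp_all
  qed
  then show ?thesis using assms unfolding apply_table_def by (intro map_cong[OF refl]) blast
qed

lemma table_power_id_iff:
  assumes p: "p permutes {1..5}"
  shows "table_power_id n (map p [1, 2, 3, 4, 5]) \<longleftrightarrow> p ^^ n = id"
proof -
  let ?L = "[1, 2, 3, 4, 5 :: nat]"
  have L: "set ?L = {1..5}" by auto
  have pn: "(p ^^ n) permutes {1..5}" for n using p by (rule permutes_funpow)
  have "(apply_table (map p ?L) ^^ n) ?L = map (p ^^ n) ?L" for n
  proof (induction n)
    case (Suc n)
    have "set (map (p ^^ n) ?L) \<subseteq> {1..5}"
      unfolding set_map L using permutes_image[OF pn] by simp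
    then have "apply_table (map p ?L) (map (p ^^ n) ?L) = map p (map (p ^^ n) ?L)" by (rule apply_table_map)
    then show ?case using Suc by simp
  qed simp
  then have "table_power_id n (map p ?L) \<longleftrightarrow> map (p ^^ n) ?L = map id ?L"
    unfolding table_power_id_def list.map_id by simp
  also have "\<dots> \<longleftrightarrow> (\<forall>i\<in>{1..5}. (p ^^ n) i = id i)" unfolding map_eq_conv L ..
  also have "\<dots> \<longleftrightarrow> p ^^ n = id" using permutes_not_in[OF pn] by (metis ext id_apply)
  finally show ?thesis .
qed

lemma alt_group_pow: "p [^]\<^bsub>alt_group n\<^esub> (k::nat) = p ^^ k"
proof (induction k)
  case 0
  then show ?case by (simp add: alt_group_one)
next
  case (Suc k)
  then show ?case by (simp add: alt_group_mult funpow_swap1 fun_eq_iff)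
qed

lemma perm_table_alt_group:
  "set (perm_table [1, 2, 3, 4, 5]) \<inter> {(xs, s). s} = (\<lambda>p. (map p [1, 2, 3, 4, 5], True)) ` carrier (alt_group 5)"
proof -
  have "set [1, 2, 3, 4, 5 :: nat] = {1..5}" by auto
  then have "set (perm_table [1, 2, 3, 4, 5]) =
      (\<lambda>p. (map p [1, 2, 3, 4, 5], evenperm p)) ` {p. p permutes {1..5}}"
    using set_perm_table[of "[1, 2, 3, 4, 5]"] by simp
  then show ?thesis by (auto simp: alt_group_carrier)
qed

lemma table_count:
  "card {p \<in> carrier (alt_group 5). p ^^ n = id} =
    length (remdups (map fst (filter (\<lambda>(xs, s). s \<and> table_power_id n xs) (perm_table [1, 2, 3, 4, 5]))))"
proof -
  let ?L = "[1, 2, 3, 4, 5 :: nat]" and ?C = "{p \<in> carrier (alt_group 5). p ^^ n = id}"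
  have L: "set ?L = {1..5}" by auto
  have "set (map fst (filter (\<lambda>(xs, s). s \<and> table_power_id n xs) (perm_table ?L))) =
      {xs. (xs, True) \<in> set (perm_table ?L) \<inter> {(xs, s). s} \<and> table_power_id n xs}"
    by force
  also have "\<dots> = (\<lambda>p. map p ?L) ` ?C"
    unfolding perm_table_alt_group using table_power_id_iff[of _ n] by (auto simp: alt_group_carrier)
  finally have *: "set (map fst (filter (\<lambda>(xs, s). s \<and> table_power_id n xs) (perm_table ?L))) =
      (\<lambda>p. map p ?L) ` ?C" .
  have "inj_on (\<lambda>p. map p ?L) ?C"
  proof (rule inj_onI)
    fix p q assume pq: "p \<in> ?C" "q \<in> ?C" "map p ?L = map q ?L"
    have per: "p permutes {1..5}" "q permutes {1..5}" using pq by (simp_all add: alt_group_carrier)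
    have "\<forall>i\<in>{1..5}. p i = q i" using pq(3) unfolding map_eq_conv L .
    then show "p = q" using permutes_not_in[OF per(1)] permutes_not_in[OF per(2)] by (metis ext)
  qed
  then show ?thesis unfolding length_remdups_card_conv * by (simp only: card_image)
qed

theorem alt_group_5_A5_like: "A5_like (alt_group 5)"
proof -
  let ?A = "alt_group 5"
  interpret group ?A by (rule alt_group_is_group)
  have card: "card (carrier ?A) = 60" using alt_group_card_carrier[of 5] by (simp add: fact_numeral)
  interpret finite_group ?A
  proof
    show "finite (carrier ?A)" by (rule card_ge_0_finite) (simp add: card)
  qed
  have pow: "p ^^ n = id \<longleftrightarrow> ord p dvd n" if "p \<in> carrier ?A" for p n
    using pow_eq_id[OF that, of n] by (simp add: alt_group_pow alt_group_one)
  have elems: "card (elems_of_ord n) = k - 1"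
    if n: "Factorial_Ring.prime n" and k: "card {p \<in> carrier ?A. p ^^ n = id} = k" for n k
  proof -
    have "{p \<in> carrier ?A. p ^^ n = id} = insert \<one>\<^bsub>?A\<^esub> (elems_of_ord n)"
    proof (intro equalityI subsetI)
      fix p assume "p \<in> {p \<in> carrier ?A. p ^^ n = id}"
      then have p: "p \<in> carrier ?A" "ord p dvd n" using pow by auto
      then have "ord p = 1 \<or> ord p = n" using n by (auto simp: prime_nat_iff)
      then show "p \<in> insert \<one>\<^bsub>?A\<^esub> (elems_of_ord n)" using ord_eq_1[OF p(1)] p(1) by (auto simp: elems_of_ord_def)
    next
      fix p assume "p \<in> insert \<one>\<^bsub>?A\<^esub> (elems_of_ord n)"
      then have "p \<in> carrier ?A" "ord p dvd n" by (auto simp: elems_of_ord_def)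
      then show "p \<in> {p \<in> carrier ?A. p ^^ n = id}" using pow by auto
    qed
    moreover have "\<one>\<^bsub>?A\<^esub> \<notin> elems_of_ord n" using n by (auto simp: elems_of_ord_def)
    moreover have "finite (elems_of_ord n)" by (simp add: elems_of_ord_def)
    ultimately show ?thesis using k by simp
  qed
  show ?thesis
  proof
    fix p assume p: "p \<in> carrier ?A"
    have per: "p permutes {1..5}" using p by (simp add: alt_group_carrier)
    have "(map p [1, 2, 3, 4, 5], True) \<in> set (perm_table [1, 2, 3, 4, 5])"
      using perm_table_alt_group p by blast
    from bspec[OF orders_in_table[unfolded list_all_iff] this]
    have "table_power_id 2 (map p [1, 2, 3, 4, 5]) \<or> table_power_id 3 (map p [1, 2, 3, 4, 5]) \<or>
        table_power_id 5 (map p [1, 2, 3, 4, 5])"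
      unfolding prod.case by (rule mp) (rule TrueI)
    then have "ord p dvd 2 \<or> ord p dvd 3 \<or> ord p dvd 5"
      unfolding table_power_id_iff[OF per] pow[OF p] .
    moreover have "ord p \<in> {1, q}" if "ord p dvd q" "Factorial_Ring.prime q" for q
      using that by (auto simp: prime_nat_iff)
    from this[of 2] this[of 3] this[of 5]
    have "ord p dvd 2 \<Longrightarrow> ord p \<in> {1, 2}" "ord p dvd 3 \<Longrightarrow> ord p \<in> {1, 3}" "ord p dvd 5 \<Longrightarrow> ord p \<in> {1, 5}"
      by simp_all
    ultimately show "ord p \<in> {1, 2, 3, 5}" by blast
  next
    show "order ?A = 60" using card by (simp add: order_def)
    show "card (elems_of_ord 3) = 20" using elems[of 3] table_count[of 3] count_pow_3 by simp
    show "card (elems_of_ord 5) = 24" using elems[of 5] table_count[of 5] count_pow_5 by simp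
  qed
qed

theorem kappa_alt_group_5: "kappa (alt_group 5) = 3 ^ 10 * 5 ^ 18"
proof -
  interpret A5_like "alt_group 5" by (rule alt_group_5_A5_like)
  obtain c3 c5 where "kappa (alt_group 5) = 3 ^ c3 * 5 ^ (3 * c5)"
    "card (elems_of_ord 3) = 2 * c3" "card (elems_of_ord 5) = 4 * c5"
    by (rule kappa_if_orders_2_3_5[OF ords])
  moreover from this have "c3 = 10" "c5 = 6" using card_3 card_5 by auto
  ultimately show ?thesis by simp
qed

text \<open>
  The type of the group elements is arbitrary here: the theorem below uses this both for permutations and
  for its type variable.
\<close>

lemma iso_alt_group_5_if_kappa:
  assumes "simple_group H" "finite (carrier H)" and kappa: "kappa H = kappa (alt_group 5)"
  shows "H \<cong> alt_group 5"
proof -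
  interpret simple_group H by fact
  interpret finite_simple_group H by unfold_locales fact
  have kap: "kappa H = 3 ^ 10 * 5 ^ 18" using kappa kappa_alt_group_5 by simp
  interpret A5_like H
    by unfold_locales (use orders_if_kappa[OF kap] order_if_kappa[OF kap] elems_of_ord_if_kappa[OF kap] in auto)
  show ?thesis by (rule iso_alt_group_5)
qed

theorem theorem1p1:
  shows "kappa_recognizable (finite_simple_groups :: (nat \<Rightarrow> nat) monoid set) (alt_group 5) \<and>
    (\<forall>H :: 'a monoid. simple_group H \<and> finite (carrier H) \<and> kappa H = kappa (alt_group 5)
       \<longrightarrow> H \<cong> alt_group 5)"
proof
  show "\<forall>H :: 'a monoid. simple_group H \<and> finite (carrier H) \<and> kappa H = kappa (alt_group 5)
      \<longrightarrow> H \<cong> alt_group 5"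
    using iso_alt_group_5_if_kappa by blast
next
  interpret A5_like "alt_group 5" by (rule alt_group_5_A5_like)
  let ?C = "finite_simple_groups :: (nat \<Rightarrow> nat) monoid set"
  have A5: "alt_group 5 \<in> ?C" using simple by (simp add: finite_simple_groups_def)
  define M where "M = {H \<in> ?C. kappa H = kappa (alt_group 5)}"
  have iso: "H \<cong> alt_group 5" if "H \<in> M" for H
    using that iso_alt_group_5_if_kappa[of H] by (simp add: M_def finite_simple_groups_def)
  have "H \<cong> K" if "H \<in> M" "K \<in> M" for H K
  proof -
    have "group K" using that(2) by (simp add: M_def finite_simple_groups_def simple_group_def)
    then have "alt_group 5 \<cong> K" using iso[OF that(2)] by (rule group.iso_sym)
    then show ?thesis using iso[OF that(1)] iso_trans by blast
  qed
  then have "{(H, K). H \<in> M \<and> K \<in> M \<and> H \<cong> K} = M \<times> M" by auto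
  moreover have "M // (M \<times> M) = {M}" using A5 by (auto simp: quotient_def M_def)
  ultimately have "kappa_num ?C (alt_group 5) = 1"
    by (simp add: kappa_num_def Let_def M_def[symmetric] one_enat_def)
  then show "kappa_recognizable ?C (alt_group 5)" using A5 by (simp add: kappa_recognizable_def)
qed

end
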